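(* Let $d\ge3$, let $k>0$, let $\Omega\subset\mathbb{R}^d$ be a bounded domain and let $F$ be an integrable function with compact support in $\Omega$. Suppose that the Toeplitz operator $\mathcal{T}_F$ in the space $\mathcal{H}(\Omega)$ of Helmholtz functions (the $L_2(\Omega)$ solutions of $\Delta u+k^2u=0$ in $\Omega$) has finite rank. Then $F=0$ (almost everywhere).
   Context: $\mathcal{H}(\Omega)$ is the closed subspace of $L_2(\Omega)$ (Lebesgue measure) consisting of solutions of the Helmholtz equation $\Delta u+k^2u=0$ in $\Omega$. The Toeplitz operator $\mathcal{T}_F:\mathcal{H}(\Omega)\to\mathcal{H}(\Omega)$ is defined by its sesquilinear form $$(\mathcal{T}_Fu,v)=\langle F,u\bar v\rangle=\int_\Omega F\,u\,\bar v\,dx,\qquad u,v\in\mathcal{H}(\Omega).$$ *)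

theory Defs
  imports "HOL-Analysis.Analysis"
begin

definition partial_deriv :: "'a::euclidean_space \<Rightarrow> ('a \<Rightarrow> complex) \<Rightarrow> 'a \<Rightarrow> complex" where
  "partial_deriv b u x = frechet_derivative u (at x) b"

definition laplacian :: "('a::euclidean_space \<Rightarrow> complex) \<Rightarrow> 'a \<Rightarrow> complex" where
  "laplacian u x = (\<Sum>b\<in>Basis. partial_deriv b (partial_deriv b u) x)"

text \<open>Meant for open sets. The differentiability clauses ensure that the
  derivatives taken by \<^const>\<open>partial_deriv\<close> exist, so that they are not junk values.\<close>

definition C2_on :: "'a::euclidean_space set \<Rightarrow> ('a \<Rightarrow> complex) \<Rightarrow> bool" where
  "C2_on S u \<longleftrightarrow>
     (\<forall>x\<in>S. u differentiable (at x)) \<and>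
     (\<forall>b\<in>Basis. \<forall>x\<in>S. partial_deriv b u differentiable (at x)) \<and>
     (\<forall>b\<in>Basis. \<forall>c\<in>Basis. continuous_on S (partial_deriv c (partial_deriv b u)))"

text \<open>The space of \<open>L\<^sub>2\<close> solutions of the Helmholtz equation on an open set \<open>\<Omega>\<close>.
  By elliptic regularity every class in \<open>L\<^sub>2(\<Omega>)\<close> that solves the equation weakly has exactly
  one classical (twice continuously differentiable) representative on \<open>\<Omega>\<close>, and the class is
  represented by that function. Values outside \<open>\<Omega>\<close> are set to zero, so that equality of
  elements of the space is equality of functions.\<close>

definition helmholtz_space :: "real \<Rightarrow> 'a::euclidean_space set \<Rightarrow> ('a \<Rightarrow> complex) set" where
  "helmholtz_space k \<Omega> =
     {u. C2_on \<Omega> u \<and>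
         (\<forall>x\<in>\<Omega>. laplacian u x + of_real (k\<^sup>2) * u x = 0) \<and>
         set_integrable lebesgue \<Omega> (\<lambda>x. (cmod (u x))\<^sup>2) \<and>
         (\<forall>x. x \<notin> \<Omega> \<longrightarrow> u x = 0)}"

definition L2_inner ::
  "'a::euclidean_space set \<Rightarrow> ('a \<Rightarrow> complex) \<Rightarrow> ('a \<Rightarrow> complex) \<Rightarrow> complex" where
  "L2_inner \<Omega> u v = set_lebesgue_integral lebesgue \<Omega> (\<lambda>x. u x * cnj (v x))"

definition toeplitz_form ::
  "'a::euclidean_space set \<Rightarrow> ('a \<Rightarrow> complex) \<Rightarrow> ('a \<Rightarrow> complex) \<Rightarrow> ('a \<Rightarrow> complex) \<Rightarrow> complex" where
  "toeplitz_form \<Omega> F u v = set_lebesgue_integral lebesgue \<Omega> (\<lambda>x. F x * u x * cnj (v x))"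

text \<open>\<open>T\<close> is the operator on the Helmholtz space given by the sesquilinear form of the
  symbol \<open>F\<close>. For \<open>F\<close> integrable with compact support in \<open>\<Omega>\<close> the form is bounded, so such a
  \<open>T\<close> exists by the Riesz representation theorem; its restriction to the Helmholtz space is
  uniquely determined, and it is linear there. Values of \<open>T\<close> outside the space are irrelevant.\<close>

definition is_toeplitz_operator ::
  "real \<Rightarrow> 'a::euclidean_space set \<Rightarrow> ('a \<Rightarrow> complex) \<Rightarrow>
   (('a \<Rightarrow> complex) \<Rightarrow> ('a \<Rightarrow> complex)) \<Rightarrow> bool" where
  "is_toeplitz_operator k \<Omega> F T \<longleftrightarrow>
     T \<in> helmholtz_space k \<Omega> \<rightarrow> helmholtz_space k \<Omega> \<and>
     (\<forall>u\<in>helmholtz_space k \<Omega>. \<forall>v\<in>helmholtz_space k \<Omega>.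
        L2_inner \<Omega> (T u) v = toeplitz_form \<Omega> F u v)"

text \<open>The range of \<open>T\<close> on \<open>H\<close> lies in the complex linear span of finitely many elements of \<open>H\<close>.\<close>

definition finite_rank_on ::
  "('a \<Rightarrow> complex) set \<Rightarrow> (('a \<Rightarrow> complex) \<Rightarrow> ('a \<Rightarrow> complex)) \<Rightarrow> bool" where
  "finite_rank_on H T \<longleftrightarrow>
     (\<exists>B. finite B \<and> B \<subseteq> H \<and> (\<forall>u\<in>H. \<exists>c. T u = (\<lambda>x. \<Sum>b\<in>B. c b * b x)))"

text \<open>Compactness of the essential support inside \<open>\<Omega>\<close>, as appropriate for a function given
  up to null sets. Values of \<open>F\<close> outside \<open>\<Omega>\<close> play no role.\<close>

definition compact_support_in :: "'a::euclidean_space set \<Rightarrow> ('a \<Rightarrow> complex) \<Rightarrow> bool" where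
  "compact_support_in \<Omega> F \<longleftrightarrow>
     (\<exists>K. compact K \<and> K \<subseteq> \<Omega> \<and> (AE x in lebesgue. x \<in> \<Omega> - K \<longrightarrow> F x = 0))"

end

theory Submission
  imports Defs "HOL-Complex_Analysis.Complex_Analysis" "Jordan_Normal_Form.Determinant"
begin

text \<open>
  For orthonormal \<open>a, b, e\<close> and \<open>z x = a \<bullet> x + i (b \<bullet> x)\<close> the plane waves
  \<open>exp (i (k (e \<bullet> x) + t z x))\<close>, \<open>t\<close> complex, solve the Helmholtz equation, since
  \<open>a + i b\<close> is isotropic and orthogonal to \<open>e\<close>. Testing the form against pairs of them
  cancels the factor in the direction \<open>e\<close>, so that
  \<open>h t s = \<integral> F x exp (i (t z x + s (cnj (z x)))) dx\<close> is a finite sum of products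
  \<open>c t * b s\<close>. If the number \<open>n\<close> of terms is minimal and positive, the determinant
  \<open>D t s = det (h (t + p i) (s + q j))\<close> of size \<open>n\<close> factors as \<open>C t * B s\<close> and is nonzero
  at \<open>(0, 0)\<close> for suitable nodes \<open>p, q\<close>. For \<open>s = cnj t\<close> its entries are Fourier transforms
  of integrable functions, so \<open>D t (cnj t)\<close> is bounded and has limit \<open>0\<close> along \<open>t = 1, 2, \<dots>\<close>.
  Its absolute value is, up to a constant factor, that of the entire function
  \<open>D t 0 * cnj (D 0 (cnj t))\<close>, which therefore vanishes by Liouville's theorem: a
  contradiction. Hence \<open>h = 0\<close>, so the Fourier transform of \<open>F\<close> vanishes on every line
  through the origin, and \<open>F = 0\<close>.
\<close>

section \<open>Kernels of finite rank\<close>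

text \<open>By induction on \<open>n\<close>: either all sampled determinants of the smaller size
  vanish as well, or one is nonzero at some nodes. In the latter case the last sample is left free
  and the determinant expanded along its row. The cofactors do not depend on that sample, so they
  are the coefficients of a relation, and the last one is the nonzero smaller determinant.\<close>

lemma dependent_if_sample_dets_vanish:
  fixes c :: "nat \<Rightarrow> 'b \<Rightarrow> complex"
  assumes "\<And>p. Determinant.det (mat n n (\<lambda>(i, k). c k (p i))) = 0"
  shows "\<exists>a. (\<exists>k<n. a k \<noteq> 0) \<and> (\<forall>t. (\<Sum>k<n. a k * c k t) = 0)"
  using assms
proof (induction n)
  case 0
  then show ?case by simp
next
  case (Suc n)
  show ?case
  proof (cases "\<forall>p. Determinant.det (mat n n (\<lambda>(i, k). c k (p i))) = 0")
    case True
    then obtain a where a: "\<exists>k<n. a k \<noteq> 0" "\<forall>t. (\<Sum>k<n. a k * c k t) = 0"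
      using Suc.IH by blast
    show ?thesis
      by (rule exI[of _ "a(n := 0)"]) (use a in \<open>auto intro: less_SucI\<close>)
  next
    case False
    then obtain p where p: "Determinant.det (mat n n (\<lambda>(i, k). c k (p i))) \<noteq> 0"
      by blast
    define A where "A t = mat (Suc n) (Suc n) (\<lambda>(i, k). c k ((p(n := t)) i))" for t
    define a where
      "a j = (-1) ^ (n + j) *
        Determinant.det (mat n n (\<lambda>(i, k). c (if k < j then k else Suc k) (p i)))" for j
    have minor: "cofactor (A t) n j = a j" if "j < Suc n" for t j
    proof -
      have "mat_delete (A t) n j = mat n n (\<lambda>(i, k). c (if k < j then k else Suc k) (p i))"
        using that by (intro eq_matI) (auto simp: mat_delete_def A_def)
      then show ?thesis
        by (simp add: cofactor_def a_def)
    qed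
    have "(\<Sum>k<Suc n. a k * c k t) = 0" for t
    proof -
      have "0 = Determinant.det (A t)"
        unfolding A_def by (rule Suc.prems[symmetric])
      also have "\<dots> = (\<Sum>j<Suc n. A t $$ (n, j) * cofactor (A t) n j)"
        by (rule laplace_expansion_row) (auto simp: A_def)
      also have "\<dots> = (\<Sum>j<Suc n. a j * c j t)"
        by (intro sum.cong refl) (simp add: minor, simp add: A_def)
      finally show ?thesis by simp
    qed
    moreover have "mat n n (\<lambda>(i, k). c (if k < n then k else Suc k) (p i)) =
        mat n n (\<lambda>(i, k). c k (p i))"
      by (intro eq_matI) auto
    then have "a n \<noteq> 0"
      using p by (simp add: a_def)
    ultimately show ?thesis by blast
  qed
qed

text \<open>The relation is solved for \<open>c k\<close>, and the \<open>k\<close>-th term is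
  absorbed by correcting each remaining \<open>b j\<close> by a multiple of \<open>b k\<close>. The
  bijection \<open>g\<close> renumbers the surviving indices.\<close>

lemma reduce_rank:
  fixes c :: "nat \<Rightarrow> 'b \<Rightarrow> complex" and b :: "nat \<Rightarrow> 'c \<Rightarrow> complex"
  assumes "k < Suc n" "a k \<noteq> 0" "\<And>t. (\<Sum>j<Suc n. a j * c j t) = 0"
  shows "\<exists>c' b'. \<forall>t s. (\<Sum>j<Suc n. c j t * b j s) = (\<Sum>j<n. c' j t * b' j s)"
proof -
  let ?J = "{..<Suc n} - {k}"
  have "card ?J = n"
    using assms(1) by simp
  then obtain g where g: "bij_betw g {0..<n} ?J"
    using ex_bij_betw_nat_finite[of ?J] by auto
  have ck: "c k t = - (\<Sum>j\<in>?J. a j / a k * c j t)" for t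
  proof -
    have "a k * c k t + (\<Sum>j\<in>?J. a j * c j t) = 0"
      using assms(1,3) by (subst sum.remove[symmetric]) auto
    then have "c k t = - (\<Sum>j\<in>?J. a j * c j t) / a k"
      using assms(2) by (simp add: field_simps add_eq_0_iff)
    then show ?thesis
      by (simp add: sum_divide_distrib)
  qed
  have "(\<Sum>j<Suc n. c j t * b j s) = (\<Sum>j<n. c (g j) t * (b (g j) s - a (g j) / a k * b k s))"
    for t s
  proof -
    have "(\<Sum>j<Suc n. c j t * b j s) = c k t * b k s + (\<Sum>j\<in>?J. c j t * b j s)"
      using assms(1) by (subst sum.remove[of _ k]) auto
    also have "\<dots> = (\<Sum>j\<in>?J. c j t * (b j s - a j / a k * b k s))"
      unfolding ck by (simp add: algebra_simps sum_subtractf sum_distrib_left)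
    also have "\<dots> = (\<Sum>j\<in>{0..<n}. c (g j) t * (b (g j) s - a (g j) / a k * b k s))"
      by (rule sum.reindex_bij_betw[OF g, symmetric])
    finally show ?thesis
      by (simp add: lessThan_atLeast0)
  qed
  then show ?thesis by (intro exI allI)
qed

text \<open>The Leibniz formula with signs of modulus one. The bound depends on \<open>M\<close>
  alone, so entries bounded uniformly in a parameter give a uniformly bounded determinant.\<close>

lemma norm_det_le:
  fixes M :: "nat \<Rightarrow> nat \<Rightarrow> real" and H :: "nat \<Rightarrow> nat \<Rightarrow> complex"
  assumes "\<And>i j. norm (H i j) \<le> M i j"
  shows "norm (Determinant.det (mat n n (\<lambda>(i, j). H i j))) \<le>
    (\<Sum>p\<in>{p. p permutes {0..<n}}. \<Prod>i=0..<n. M i (p i))"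
proof -
  have "norm (Determinant.det (mat n n (\<lambda>(i, j). H i j))) \<le>
    (\<Sum>p\<in>{p. p permutes {0..<n}}.
       norm (signof p * (\<Prod>i=0..<n. mat n n (\<lambda>(i, j). H i j) $$ (i, p i))))"
    by (subst det_def'[of _ n]) (auto intro: norm_sum)
  also have "\<dots> \<le> (\<Sum>p\<in>{p. p permutes {0..<n}}. \<Prod>i=0..<n. M i (p i))"
  proof (rule sum_mono)
    fix p assume "p \<in> {p. p permutes {0..<n}}"
    then have *: "p i < n" if "i < n" for i
      using permutes_in_image[of p "{0..<n}" i] that by auto
    have "norm (signof p * (\<Prod>i=0..<n. mat n n (\<lambda>(i, j). H i j) $$ (i, p i))) =
        (\<Prod>i=0..<n. norm (H i (p i)))"
      using * by (auto simp: norm_mult sign_def prod_norm[symmetric] intro!: prod.cong)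
    also have "\<dots> \<le> (\<Prod>i=0..<n. M i (p i))"
      by (intro prod_mono) (auto simp: assms)
    finally show "norm (signof p * (\<Prod>i=0..<n. mat n n (\<lambda>(i, j). H i j) $$ (i, p i))) \<le>
        (\<Prod>i=0..<n. M i (p i))" .
  qed
  finally show ?thesis .
qed

text \<open>Without the matrix access, the Leibniz formula is a polynomial in the
  \<open>H i j\<close>, to which the rules for holomorphy and limits apply.\<close>

lemma det_mat_expand:
  "Determinant.det (mat n n (\<lambda>(i, j). H i j)) =
     (\<Sum>p\<in>{p. p permutes {0..<n}}. signof p * (\<Prod>i=0..<n. H i (p i)))"
  for H :: "nat \<Rightarrow> nat \<Rightarrow> complex"
proof -
  have "(\<Prod>i=0..<n. mat n n (\<lambda>(i, j). H i j) $$ (i, p i)) = (\<Prod>i=0..<n. H i (p i))"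
    if "p permutes {0..<n}" for p
    using permutes_in_image[OF that] by (intro prod.cong) auto
  then show ?thesis
    by (subst det_def'[of _ n]) auto
qed

text \<open>The four analytic hypotheses speak of \<open>h\<close> alone, so the induction on
  \<open>n\<close> may change \<open>c\<close> and \<open>b\<close> freely. It takes the place of
  choosing a minimal number of terms.\<close>

lemma finite_rank_kernel_vanishes:
  fixes h :: "complex \<Rightarrow> complex \<Rightarrow> complex" and n :: nat
  assumes hol1: "\<And>s. (\<lambda>t. h t s) holomorphic_on UNIV"
    and hol2: "\<And>t. (\<lambda>s. h t s) holomorphic_on UNIV"
    and bdd: "\<And>t0 s0. \<exists>M. \<forall>t. norm (h (t + t0) (cnj t + s0)) \<le> M"
    and lim: "\<And>t0 s0. (\<lambda>m. h (of_nat m + t0) (of_nat m + s0)) \<longlonglongrightarrow> 0"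
    and rank: "\<And>t s. h t s = (\<Sum>j<n. c j t * b j s)"
  shows "h t s = 0"
  using rank
proof (induction n arbitrary: c b)
  case 0
  then show ?case by simp
next
  case (Suc n)
  let ?N = "Suc n"
  \<comment> \<open>If the sampled determinants of one factor vanish for all nodes, that factor is
    linearly dependent and the rank drops. Otherwise both factors supply nodes, \<open>p\<close> and
    \<open>q\<close>, for the determinant argument.\<close>
  consider "\<And>p. Determinant.det (mat ?N ?N (\<lambda>(i, k). c k (p i))) = 0"
    | "\<And>q. Determinant.det (mat ?N ?N (\<lambda>(i, k). b k (q i))) = 0"
    | p q where "Determinant.det (mat ?N ?N (\<lambda>(i, k). c k (p i))) \<noteq> 0"
      "Determinant.det (mat ?N ?N (\<lambda>(i, k). b k (q i))) \<noteq> 0"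
    by blast
  then show ?case
  proof cases
    case 1
    from dependent_if_sample_dets_vanish[of ?N c, OF this] obtain a k
      where "k < ?N" "a k \<noteq> 0" "\<And>t. (\<Sum>j<?N. a j * c j t) = 0" by blast
    from reduce_rank[of k n a c b, OF this] obtain c' b' where
      "\<And>t s. (\<Sum>j<?N. c j t * b j s) = (\<Sum>j<n. c' j t * b' j s)" by blast
    then show ?thesis
      using Suc.prems by (intro Suc.IH[of c' b']) metis
  next
    case 2
    from dependent_if_sample_dets_vanish[of ?N b, OF this] obtain a k
      where "k < ?N" "a k \<noteq> 0" "\<And>t. (\<Sum>j<?N. a j * b j t) = 0" by blast
    from reduce_rank[of k n a b c, OF this] obtain c' b' where
      "\<And>s t. (\<Sum>j<?N. b j s * c j t) = (\<Sum>j<n. b' j s * c' j t)" by blast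
    then have "\<And>t s. (\<Sum>j<?N. c j t * b j s) = (\<Sum>j<n. c' j t * b' j s)"
      by (simp only: mult.commute)
    then show ?thesis
      using Suc.prems by (intro Suc.IH[of c' b']) metis
  next
    case 3
    define D where "D t s = Determinant.det (mat ?N ?N (\<lambda>(i, j). h (t + p i) (s + q j)))" for t s
    define C where "C t = Determinant.det (mat ?N ?N (\<lambda>(i, k). c k (t + p i)))" for t
    define B where "B s = Determinant.det (mat ?N ?N (\<lambda>(i, k). b k (s + q i)))" for s
    have fac: "D t s = C t * B s" for t s
    proof -
      let ?P = "mat ?N ?N (\<lambda>(i, k). c k (t + p i))"
      let ?Q = "mat ?N ?N (\<lambda>(i, k). b k (s + q i))"
      have "mat ?N ?N (\<lambda>(i, j). h (t + p i) (s + q j)) = ?P * transpose_mat ?Q"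
        by (intro eq_matI)
          (auto simp: scalar_prod_def Suc.prems lessThan_atLeast0 intro!: sum.cong
             simp del: sum.lessThan_Suc sum.op_ivl_Suc)
      then have "D t s = Determinant.det ?P * Determinant.det (transpose_mat ?Q)"
        unfolding D_def by (simp add: det_mult[of _ ?N])
      then show ?thesis
        by (simp add: det_transpose[of _ ?N] C_def B_def)
    qed
    have D0: "D 0 0 \<noteq> 0"
      using 3 by (simp add: fac C_def B_def)
    \<comment> \<open>\<open>D t (cnj t)\<close> need not be holomorphic in \<open>t\<close>.
      Conjugating the factor that depends on \<open>cnj t\<close> makes it so and changes the
      modulus by a constant factor only.\<close>
    define \<phi> where "\<phi> t = D t 0 * cnj (D 0 (cnj t))" for t
    have shift: "(\<lambda>t. f (t + r)) holomorphic_on UNIV"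
      if "f holomorphic_on UNIV" for f :: "complex \<Rightarrow> complex" and r
      using holomorphic_on_compose_gen[OF _ that, of "\<lambda>t. t + r" UNIV]
      by (simp add: o_def holomorphic_intros)
    have "(\<lambda>t. D t 0) holomorphic_on UNIV"
      unfolding D_def det_mat_expand
      by (intro holomorphic_intros shift hol1)
    moreover have "D 0 holomorphic_on UNIV"
      unfolding D_def[abs_def] det_mat_expand
      by (intro holomorphic_intros shift hol2)
    then have "(\<lambda>t. cnj (D 0 (cnj t))) holomorphic_on UNIV"
      using holomorphic_on_compose_cnj_cnj[of "D 0" UNIV]
      by (simp add: o_def holomorphic_on_subset)
    ultimately have hol: "\<phi> holomorphic_on UNIV"
      unfolding \<phi>_def[abs_def] by (intro holomorphic_intros)
    \<comment> \<open>By \<open>fac\<close>, both sides are the product of the moduli of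
      \<open>C t\<close>, \<open>B (cnj t)\<close>, \<open>C 0\<close> and
      \<open>B 0\<close>.\<close>
    have norm_\<phi>: "norm (\<phi> t) = norm (D t (cnj t)) * norm (D 0 0)" for t
      by (simp add: \<phi>_def fac norm_mult)
    obtain M where "\<And>t0 s0 t. norm (h (t + t0) (cnj t + s0)) \<le> M t0 s0"
      using that[of "\<lambda>t0 s0. SOME M. \<forall>t. norm (h (t + t0) (cnj t + s0)) \<le> M"] someI_ex[OF bdd]
      by blast
    then have M: "norm (h (t + p i) (cnj t + q j)) \<le> M (p i) (q j)" for i j t .
    have "norm (\<phi> t) \<le> (\<Sum>\<sigma>\<in>{\<sigma>. \<sigma> permutes {0..<?N}}. \<Prod>i=0..<?N. M (p i) (q (\<sigma> i))) * norm (D 0 0)"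
      for t
      unfolding norm_\<phi> D_def
      by (intro mult_right_mono norm_det_le[where M = "\<lambda>i j. M (p i) (q j)"] M) simp
    then have "bounded (range \<phi>)"
      unfolding bounded_iff by blast
    then obtain w where w: "\<And>t. \<phi> t = w"
      using Liouville_theorem[OF hol] by (auto simp: constant_on_def)
    \<comment> \<open>The points \<open>of_nat m\<close> are real, so they satisfy
      \<open>s = cnj t\<close>. Each product has \<open>Suc n\<close> factors, hence at least one,
      and so tends to 0.\<close>
    have "(\<lambda>m. D (of_nat m) (of_nat m)) \<longlonglongrightarrow>
       (\<Sum>p\<in>{p. p permutes {0..<?N}}. signof p * (\<Prod>i=0..<?N. 0))"
      unfolding D_def det_mat_expand
      by (intro tendsto_intros lim)
    then have "(\<lambda>m. norm (D (of_nat m) (of_nat m)) * norm (D 0 0)) \<longlonglongrightarrow> 0 * norm (D 0 0)"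
      by (intro tendsto_mult tendsto_const) (simp add: tendsto_norm_zero)
    then have "(\<lambda>m. norm (\<phi> (of_nat m))) \<longlonglongrightarrow> 0"
      by (simp add: norm_\<phi>)
    then have "\<phi> 0 = 0"
      using w by (simp add: LIMSEQ_const_iff)
    then show ?thesis
      using D0 by (simp add: \<phi>_def)
  qed
qed

section \<open>Holomorphic dependence of exponential integrals on the parameter\<close>

text \<open>Expanding \<open>exp\<close> turns the integral into a power series with coefficients
  \<open>a n\<close>. The bound on \<open>w\<close> where \<open>f\<close> is nonzero justifies
  exchanging sum and integral for every \<open>t\<close>, so the series converges
  everywhere.\<close>

lemma holomorphic_exp_transform:
  fixes f w :: "'a \<Rightarrow> complex"
  assumes f: "integrable M f" and w: "w \<in> borel_measurable M"
    and B: "\<And>x. f x \<noteq> 0 \<Longrightarrow> norm (w x) \<le> B"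
  shows "(\<lambda>t. \<integral>x. f x * exp (t * w x) \<partial>M) holomorphic_on UNIV"
proof -
  define H where "H t = (\<integral>x. f x * exp (t * w x) \<partial>M)" for t
  define a where "a n = (\<integral>x. f x * (w x) ^ n /\<^sub>R fact n \<partial>M)" for n
  have [measurable]: "f \<in> borel_measurable M" "w \<in> borel_measurable M"
    using f w by auto
  \<comment> \<open>\<open>B\<close> may be negative when \<open>f\<close> is identically zero;
    \<open>C\<close> is a nonnegative bound.\<close>
  define C where "C = max 0 B"
  have C: "0 \<le> C" "\<And>x. f x \<noteq> 0 \<Longrightarrow> norm (w x) \<le> C"
    using B by (auto simp: C_def le_max_iff_disj)
  have "(\<lambda>n. a n * t ^ n) sums H t" for t
  proof -
    define G where "G n x = f x * ((t * w x) ^ n /\<^sub>R fact n)" for n x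
    have bound: "norm (G n x) \<le> norm (f x) * ((norm t * C) ^ n /\<^sub>R fact n)" for n x
    proof (cases "f x = 0")
      case False
      have "norm (G n x) = norm (f x) * ((norm t * norm (w x)) ^ n /\<^sub>R fact n)"
        by (simp add: G_def norm_mult norm_power)
      also have "\<dots> \<le> norm (f x) * ((norm t * C) ^ n /\<^sub>R fact n)"
        using C(2)[OF False] by (intro mult_left_mono scaleR_left_mono power_mono) auto
      finally show ?thesis .
    qed (simp add: G_def)
    have summ: "summable (\<lambda>n. c * ((norm t * C) ^ n /\<^sub>R fact n))" for c :: real
      by (intro summable_mult summable_exp_generic)
    have G_int: "integrable M (G n)" for n
    proof (rule Bochner_Integration.integrable_bound)
      show "integrable M (\<lambda>x. norm (f x) * ((norm t * C) ^ n /\<^sub>R fact n))"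
        using f by (intro integrable_mult_left) auto
      show "AE x in M. norm (G n x) \<le> norm (norm (f x) * ((norm t * C) ^ n /\<^sub>R fact n))"
        using bound C(1) by simp
    qed (unfold G_def, measurable)
    have "(\<lambda>n. integral\<^sup>L M (G n)) sums (\<integral>x. (\<Sum>n. G n x) \<partial>M)"
    proof (rule sums_integral[OF G_int])
      show "AE x in M. summable (\<lambda>n. norm (G n x))"
        using bound by (intro AE_I2 summable_comparison_test'[OF summ]) auto
      show "summable (\<lambda>n. \<integral>x. norm (G n x) \<partial>M)"
      proof (rule summable_comparison_test'[OF summ])
        fix n
        have "(\<integral>x. norm (G n x) \<partial>M) \<le> (\<integral>x. norm (f x) * ((norm t * C) ^ n /\<^sub>R fact n) \<partial>M)"
          using f G_int bound by (intro integral_mono) auto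
        then show "norm (\<integral>x. norm (G n x) \<partial>M) \<le> (\<integral>x. norm (f x) \<partial>M) * ((norm t * C) ^ n /\<^sub>R fact n)"
          by simp
      qed
    qed
    moreover have "integral\<^sup>L M (G n) = a n * t ^ n" for n
    proof -
      have "integral\<^sup>L M (G n) = (\<integral>x. f x * (w x) ^ n /\<^sub>R fact n * t ^ n \<partial>M)"
        by (intro Bochner_Integration.integral_cong) (auto simp: G_def power_mult_distrib mult_ac)
      then show ?thesis by (simp add: a_def)
    qed
    moreover have "(\<Sum>n. G n x) = f x * exp (t * w x)" for x
      unfolding G_def exp_def by (intro suminf_mult summable_exp_generic)
    ultimately show ?thesis
      by (simp add: H_def)
  qed
  then have "H holomorphic_on ball 0 r" for r
    by (intro power_series_holomorphic[of 0 r a]) simp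
  then have "H field_differentiable at t" for t
    using holomorphic_on_imp_differentiable_at[of H "ball 0 (norm t + 1)" t] by simp
  then show ?thesis
    by (simp add: holomorphic_on_def H_def[abs_def])
qed

section \<open>Approximation by continuous functions\<close>

text \<open>The bound is asked for only where \<open>f\<close> is nonzero, so that exponentials
  unbounded on the whole space may multiply a function of compact support.\<close>

lemma integrable_mult_bounded:
  fixes f g :: "'a \<Rightarrow> complex"
  assumes f: "integrable M f" and g: "g \<in> borel_measurable M"
    and B: "\<And>x. f x \<noteq> 0 \<Longrightarrow> norm (g x) \<le> B"
  shows "integrable M (\<lambda>x. f x * g x)"
proof (rule Bochner_Integration.integrable_bound)
  show "integrable M (\<lambda>x. \<bar>B\<bar> *\<^sub>R f x)"
    using f by simp
  show "AE x in M. norm (f x * g x) \<le> norm (\<bar>B\<bar> *\<^sub>R f x)"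
  proof (rule AE_I2)
    fix x
    show "norm (f x * g x) \<le> norm (\<bar>B\<bar> *\<^sub>R f x)"
      using B[of x] by (cases "f x = 0") (auto simp: norm_mult mult.commute intro!: mult_right_mono)
  qed
qed (use f g in \<open>auto intro: borel_measurable_times\<close>)

lemma continuous_borel_measurable_lebesgue:
  fixes g :: "'a::euclidean_space \<Rightarrow> 'b::topological_space"
  assumes "continuous_on UNIV g"
  shows "g \<in> borel_measurable lebesgue"
  using borel_measurable_continuous_onI[OF assms] by (simp add: measurable_completion)

text \<open>A measurable function is the limit of continuous ones off a negligible set. Composing
  these with the nearest-point projection onto the ball of radius \<open>M\<close> enforces the
  bound, keeps continuity and fixes the limit \<open>f x\<close>.\<close>

lemma bounded_continuous_approximation:
  fixes f :: "'a::euclidean_space \<Rightarrow> complex"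
  assumes f: "f \<in> borel_measurable lebesgue" and M: "\<And>x. norm (f x) \<le> M"
  obtains g :: "nat \<Rightarrow> 'a \<Rightarrow> complex"
  where "\<And>n. continuous_on UNIV (g n)" "\<And>n x. norm (g n x) \<le> M"
    "AE x in lebesgue. (\<lambda>n. g n x) \<longlonglongrightarrow> f x"
proof -
  have "f measurable_on UNIV"
    using f by (simp add: measurable_on_iff_borel_measurable)
  then obtain N and g :: "nat \<Rightarrow> 'a \<Rightarrow> complex" where N: "negligible N"
    and g: "\<And>n. continuous_on UNIV (g n)" "\<And>x. x \<notin> N \<Longrightarrow> (\<lambda>n. g n x) \<longlonglongrightarrow> f x"
    unfolding measurable_on_def by auto
  have "0 \<le> M"
    using M[of undefined] norm_ge_zero order_trans by blast
  then have ne: "cball (0::complex) M \<noteq> {}"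
    by simp
  define p where "p = closest_point (cball (0::complex) M)"
  have p_cont: "continuous_on UNIV p"
    unfolding p_def by (rule continuous_on_closest_point) (use ne in auto)
  show ?thesis
  proof (rule that[of "\<lambda>n x. p (g n x)"])
    show "continuous_on UNIV (\<lambda>x. p (g n x))" for n
      using continuous_on_compose2[OF p_cont g(1)] by simp
    show "norm (p (g n x)) \<le> M" for n x
      using closest_point_in_set[OF closed_cball ne, of "g n x"] by (simp add: p_def)
    have "(\<lambda>n. p (g n x)) \<longlonglongrightarrow> f x" if "x \<notin> N" for x
    proof -
      have "isCont p (f x)"
        using p_cont by (simp add: continuous_on_eq_continuous_at)
      from isCont_tendsto_compose[OF this g(2)[OF that]] show ?thesis
        using M[of x] by (simp add: p_def closest_point_self)
    qed
    then have "{x. \<not> (\<lambda>n. p (g n x)) \<longlonglongrightarrow> f x} \<subseteq> N"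
      by auto
    then show "AE x in lebesgue. (\<lambda>n. p (g n x)) \<longlonglongrightarrow> f x"
      using N by (intro AE_I'[of N]) (auto simp: negligible_iff_null_sets)
  qed
qed

lemma integrable_indicator_cball:
  "integrable lebesgue (\<lambda>x::'a::euclidean_space. c * indicat_real (cball 0 R) x)"
  by (intro integrable_mult_right integrable_real_indicator) (use emeasure_bounded_finite[OF bounded_cball, of 0 R] in auto)

lemma integrable_bounded_support:
  fixes g :: "'a::euclidean_space \<Rightarrow> 'b::{banach, second_countable_topology}"
  assumes "g \<in> borel_measurable lebesgue" "\<And>x. norm (g x) \<le> B" "\<And>x. R < norm x \<Longrightarrow> g x = 0"
  shows "integrable lebesgue g"
proof (rule Bochner_Integration.integrable_bound[OF integrable_indicator_cball[of B R]])
  show "AE x in lebesgue. norm (g x) \<le> norm (B * indicat_real (cball 0 R) x)"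
  proof (rule AE_I2)
    fix x
    show "norm (g x) \<le> norm (B * indicat_real (cball 0 R) x)"
      using assms(2)[of x] assms(3)[of x] by (cases "norm x \<le> R") auto
  qed
qed (rule assms)

lemma wave_measurable [measurable]:
  "(\<lambda>x::'a::euclidean_space. exp (\<i> * of_real (inner \<xi> x))) \<in> borel_measurable lebesgue"
  by (intro continuous_borel_measurable_lebesgue continuous_intros)

lemma integrable_mult_wave:
  "integrable lebesgue F \<Longrightarrow> integrable lebesgue (\<lambda>x. F x * exp (\<i> * of_real (inner \<xi> x)))"
  for F :: "'a::euclidean_space \<Rightarrow> complex"
  by (rule integrable_mult_bounded[where B = 1]) auto

text \<open>Two applications of dominated convergence, each costing less than \<open>e / 2\<close>:
  \<open>f\<close> is truncated in argument and value, then the truncation is approximated by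
  continuous functions of bounded support.\<close>

lemma continuous_approximation_L1:
  fixes f :: "'a::euclidean_space \<Rightarrow> complex"
  assumes f: "integrable lebesgue f" and "0 < e"
  obtains g R where "continuous_on UNIV g" "\<And>x. R < norm x \<Longrightarrow> g x = 0"
    "(\<integral>x. norm (f x - g x) \<partial>lebesgue) < e"
proof -
  have [measurable]: "f \<in> borel_measurable lebesgue"
    using f by auto
  have norm_meas [measurable]: "(norm :: 'a \<Rightarrow> real) \<in> borel_measurable lebesgue"
    by (rule continuous_borel_measurable_lebesgue) (intro continuous_intros)
  define T where "T m x = (if norm x \<le> real m \<and> norm (f x) \<le> real m then f x else 0)" for m x
  have T_meas [measurable]: "T m \<in> borel_measurable lebesgue" for m
    unfolding T_def[abs_def] by measurable
  have "(\<lambda>m. \<integral>x. norm (f x - T m x) \<partial>lebesgue) \<longlonglongrightarrow> (\<integral>(x::'a). 0 \<partial>lebesgue)"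
  proof (rule integral_dominated_convergence)
    show "integrable lebesgue (\<lambda>x. norm (f x))"
      using f by simp
    show "AE x in lebesgue. (\<lambda>m. norm (f x - T m x)) \<longlonglongrightarrow> 0"
    proof (rule AE_I2)
      fix x
      have "\<forall>\<^sub>F m in sequentially. norm (f x - T m x) = 0"
        using eventually_ge_at_top[of "nat \<lceil>max (norm x) (norm (f x))\<rceil>"]
        by eventually_elim (auto simp: T_def; linarith)
      then show "(\<lambda>m. norm (f x - T m x)) \<longlonglongrightarrow> 0"
        by (rule tendsto_eventually)
    qed
  qed (auto simp: T_def)
  then have "\<forall>\<^sub>F m in sequentially. (\<integral>x. norm (f x - T m x) \<partial>lebesgue) < e / 2"
    using \<open>0 < e\<close> by (intro order_tendstoD(2)) auto
  then obtain m where m: "(\<integral>x. norm (f x - T m x) \<partial>lebesgue) < e / 2"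
    by (auto simp: eventually_sequentially)
  have Tm: "norm (T m x) \<le> real m" for x
    by (simp add: T_def)
  from bounded_continuous_approximation[OF T_meas Tm] obtain g :: "nat \<Rightarrow> 'a \<Rightarrow> complex"
    where g: "\<And>n. continuous_on UNIV (g n)" "\<And>n x. norm (g n x) \<le> real m"
      "AE x in lebesgue. (\<lambda>n. g n x) \<longlonglongrightarrow> T m x" by blast
  \<comment> \<open>A continuous cutoff: it is 1 where \<open>T m\<close> can be nonzero and 0
    beyond radius \<open>m + 1\<close>. Multiplying by it keeps the limit \<open>T m\<close> and
    gives a common bounded support.\<close>
  define \<eta> where "\<eta> x = max 0 (min 1 (real m + 1 - norm x))" for x :: 'a
  have \<eta>: "0 \<le> \<eta> x" "\<eta> x \<le> 1" "norm x \<le> real m \<Longrightarrow> \<eta> x = 1" "real m + 1 < norm x \<Longrightarrow> \<eta> x = 0" for x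
    by (auto simp: \<eta>_def)
  define G where "G n x = of_real (\<eta> x) * g n x" for n x
  have G_cont: "continuous_on UNIV (G n)" for n
    unfolding G_def \<eta>_def by (intro continuous_intros g)
  note [measurable] = continuous_borel_measurable_lebesgue[OF G_cont]
  have G_bound: "norm (G n x) \<le> real m" for n x
  proof -
    have "norm (G n x) = \<eta> x * norm (g n x)"
      using \<eta>(1) by (simp add: G_def norm_mult)
    also have "\<dots> \<le> 1 * real m"
      by (intro mult_mono g \<eta>) auto
    finally show ?thesis by simp
  qed
  have dom: "norm (T m x - G n x) \<le> 2 * real m * indicat_real (cball 0 (real m + 1)) x" for n x
  proof (cases "norm x \<le> real m + 1")
    case True
    have "norm (T m x - G n x) \<le> norm (T m x) + norm (G n x)"
      by (rule norm_triangle_ineq4)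
    then show ?thesis
      using True Tm[of x] G_bound[of n x] by simp
  qed (auto simp: T_def G_def \<eta>)
  have "(\<lambda>n. \<integral>x. norm (T m x - G n x) \<partial>lebesgue) \<longlonglongrightarrow> (\<integral>(x::'a). 0 \<partial>lebesgue)"
  proof (rule integral_dominated_convergence)
    show "integrable lebesgue (\<lambda>x::'a. 2 * real m * indicat_real (cball 0 (real m + 1)) x)"
      by (rule integrable_indicator_cball)
    show "AE x in lebesgue. (\<lambda>n. norm (T m x - G n x)) \<longlonglongrightarrow> 0"
      using g(3)
    proof eventually_elim
      case (elim x)
      have "(\<lambda>n. norm (T m x - G n x)) \<longlonglongrightarrow> norm (T m x - of_real (\<eta> x) * T m x)"
        unfolding G_def by (intro tendsto_intros elim)
      moreover have "of_real (\<eta> x) * T m x = T m x"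
        by (auto simp: T_def \<eta>)
      ultimately show ?case by simp
    qed
    show "AE x in lebesgue. norm (norm (T m x - G n x)) \<le> 2 * real m * indicat_real (cball 0 (real m + 1)) x" for n
      using dom by simp
  qed auto
  then have "\<forall>\<^sub>F n in sequentially. (\<integral>x. norm (T m x - G n x) \<partial>lebesgue) < e / 2"
    using \<open>0 < e\<close> by (intro order_tendstoD(2)) auto
  then obtain n where n: "(\<integral>x. norm (T m x - G n x) \<partial>lebesgue) < e / 2"
    by (auto simp: eventually_sequentially)
  have T_int: "integrable lebesgue (T m)"
    by (rule Bochner_Integration.integrable_bound[OF f]) (auto simp: T_def)
  have TG_int: "integrable lebesgue (\<lambda>x. T m x - G n x)"
    by (rule Bochner_Integration.integrable_bound[OF integrable_indicator_cball[of "2 * real m" "real m + 1"]])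
      (use dom[of _ n] in \<open>auto\<close>)
  have FT_int: "integrable lebesgue (\<lambda>x. f x - T m x)"
    using f T_int by (rule Bochner_Integration.integrable_diff)
  have "(\<integral>x. norm (f x - G n x) \<partial>lebesgue) \<le>
      (\<integral>x. norm (f x - T m x) + norm (T m x - G n x) \<partial>lebesgue)"
  proof (rule integral_mono)
    have "integrable lebesgue (\<lambda>x. (f x - T m x) + (T m x - G n x))"
      by (rule Bochner_Integration.integrable_add[OF FT_int TG_int])
    then show "integrable lebesgue (\<lambda>x. norm (f x - G n x))"
      by (intro integrable_norm) simp
    show "integrable lebesgue (\<lambda>x. norm (f x - T m x) + norm (T m x - G n x))"
      by (intro Bochner_Integration.integrable_add integrable_norm FT_int TG_int)
  qed (metis diff_add_cancel add_diff_eq norm_triangle_ineq)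
  also have "\<dots> = (\<integral>x. norm (f x - T m x) \<partial>lebesgue) + (\<integral>x. norm (T m x - G n x) \<partial>lebesgue)"
    by (intro Bochner_Integration.integral_add integrable_norm FT_int TG_int)
  also have "\<dots> < e"
    using m n by simp
  finally show ?thesis
    using that[of "G n" "real m + 1"] G_cont \<eta>(4) by (auto simp: G_def)
qed

section \<open>The Riemann-Lebesgue lemma\<close>

text \<open>A half-period translation reverses the sign of the exponential. Averaging the original
  and the translated integral bounds it by the L1 distance between \<open>g\<close> and its
  translate, and the translations shrink to zero.\<close>

lemma riemann_lebesgue_continuous:
  fixes g :: "'a::euclidean_space \<Rightarrow> complex"
  assumes g: "continuous_on UNIV g" and R: "\<And>x. R < norm x \<Longrightarrow> g x = 0" and "a \<noteq> 0"
  shows "(\<lambda>m. \<integral>x. g x * exp (\<i> * of_real (inner (real m *\<^sub>R a) x)) \<partial>lebesgue) \<longlonglongrightarrow> 0"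
proof -
  \<comment> \<open>The length is chosen to shift the phase by exactly \<open>pi\<close>. For
    \<open>m = 0\<close> division by zero gives \<open>v 0 = 0\<close>, so the phase identity is
    stated for positive \<open>m\<close>.\<close>
  define v where "v m = (pi / (real m * (norm a)\<^sup>2)) *\<^sub>R a" for m
  define I where "I m = (\<integral>x. g x * exp (\<i> * of_real (inner (real m *\<^sub>R a) x)) \<partial>lebesgue)" for m
  have v0: "v \<longlonglongrightarrow> 0"
  proof -
    have "(\<lambda>m. (pi / (norm a)\<^sup>2 * (1 / real m)) *\<^sub>R a) \<longlonglongrightarrow> (pi / (norm a)\<^sup>2 * 0) *\<^sub>R a"
      by (intro tendsto_intros lim_1_over_n)
    then show ?thesis
      by (simp add: v_def[abs_def] field_simps)
  qed
  have va: "inner (real m *\<^sub>R a) (v m) = pi" if "m > 0" for m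
    using that \<open>a \<noteq> 0\<close> by (simp add: v_def dot_square_norm)
  have "bounded (g ` cball 0 R)"
    by (intro compact_imp_bounded compact_continuous_image continuous_on_subset[OF g]) auto
  then obtain B0 where "\<forall>x\<in>cball 0 R. norm (g x) \<le> B0"
    by (auto simp: bounded_iff)
  then have B0: "norm (g x) \<le> B0" if "norm x \<le> R" for x
    using that by simp
  define B where "B = max 0 B0"
  have B: "norm (g x) \<le> B" for x
    using B0[of x] R[of x] by (cases "norm x \<le> R") (auto simp: B_def)
  have "0 \<le> B" by (simp add: B_def)
  note [measurable] = continuous_borel_measurable_lebesgue[OF g]
  have g_int: "integrable lebesgue g"
    by (rule integrable_bounded_support[of g B R]) (use B R in simp_all)
  have shifted_cont: "continuous_on UNIV (\<lambda>x. g (w + x))" for w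
    by (rule continuous_on_compose2[OF g]) (auto intro!: continuous_intros)
  note [measurable] = continuous_borel_measurable_lebesgue[OF shifted_cont]
  have shifted_int: "integrable lebesgue (\<lambda>x. g (w + x))" for w
  proof (rule integrable_bounded_support)
    show "g (w + x) = 0" if "R + norm w < norm x" for x
      using that norm_triangle_ineq2[of x "- w"] by (intro R) (simp add: add.commute)
  qed (use B in auto)
  text \<open>Translation by \<open>v m\<close> flips the sign of the exponential.\<close>
  have I_shift: "I m = - (\<integral>x. g (v m + x) * exp (\<i> * of_real (inner (real m *\<^sub>R a) x)) \<partial>lebesgue)"
    if "m > 0" for m
  proof -
    let ?w = "real m *\<^sub>R a"
    let ?F = "\<lambda>x. g x * exp (\<i> * of_real (inner ?w x))"
    have c: "continuous_on UNIV ?F"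
      by (intro continuous_intros g)
    have m1 [measurable]: "?F \<in> borel_measurable borel"
      by (rule borel_measurable_continuous_onI[OF c])
    have c': "continuous_on UNIV (\<lambda>x. ?F (v m + x))"
      by (rule continuous_on_compose2[OF c]) (auto intro!: continuous_intros)
    have m2 [measurable]: "(\<lambda>x. ?F (v m + x)) \<in> borel_measurable borel"
      by (rule borel_measurable_continuous_onI[OF c'])
    \<comment> \<open>Translation invariance is applied to \<open>lborel\<close>; for a Borel
      integrand, passing between it and its completion \<open>lebesgue\<close> preserves the
      integral.\<close>
    have "I m = integral\<^sup>L lborel ?F"
      unfolding I_def by (intro integral_completion) (use m1 in \<open>simp only: measurable_lborel2\<close>)
    also have "\<dots> = integral\<^sup>L (distr lborel borel ((+) (v m))) ?F"
      by (simp add: lborel_distr_plus)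
    also have "\<dots> = (\<integral>x. ?F (v m + x) \<partial>lborel)"
      by (rule integral_distr) (use m1 in auto)
    also have "\<dots> = (\<integral>x. ?F (v m + x) \<partial>lebesgue)"
      by (intro integral_completion[symmetric]) (use m2 in \<open>simp only: measurable_lborel2\<close>)
    also have "\<dots> = (\<integral>x. - (g (v m + x) * exp (\<i> * of_real (inner ?w x))) \<partial>lebesgue)"
    proof (intro Bochner_Integration.integral_cong refl)
      fix x
      have "exp (\<i> * of_real (inner ?w (v m + x))) = exp (\<i> * of_real pi) * exp (\<i> * of_real (inner ?w x))"
        using va[OF that] by (simp add: inner_add_right distrib_left exp_add del: inner_scaleR_left)
      then show "?F (v m + x) = - (g (v m + x) * exp (\<i> * of_real (inner ?w x)))"
        by (simp add: mult.commute[of \<i>])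
    qed
    finally show ?thesis by simp
  qed
  have "norm (I m) \<le> (\<integral>x. norm (g x - g (v m + x)) \<partial>lebesgue)" if "m > 0" for m
  proof -
    let ?E = "\<lambda>x. exp (\<i> * of_real (inner (real m *\<^sub>R a) x))"
    have "integrable lebesgue (\<lambda>x. g x * ?E x)" "integrable lebesgue (\<lambda>x. g (v m + x) * ?E x)"
      by (intro integrable_mult_wave g_int shifted_int)+
    then have "2 * I m = (\<integral>x. (g x - g (v m + x)) * ?E x \<partial>lebesgue)"
      using I_shift[OF that] by (simp add: I_def left_diff_distrib)
    then have "2 * norm (I m) = norm (\<integral>x. (g x - g (v m + x)) * ?E x \<partial>lebesgue)"
      by (metis norm_mult norm_numeral)
    also have "\<dots> \<le> (\<integral>x. norm ((g x - g (v m + x)) * ?E x) \<partial>lebesgue)"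
      by (rule integral_norm_bound)
    finally have "2 * norm (I m) \<le> (\<integral>x. norm (g x - g (v m + x)) \<partial>lebesgue)"
      by (simp add: norm_mult)
    then show ?thesis
      using norm_ge_zero[of "I m"] by linarith
  qed
  then have le: "\<forall>\<^sub>F m in sequentially. norm (I m) \<le> (\<integral>x. norm (g x - g (v m + x)) \<partial>lebesgue)"
    by (rule eventually_mono[OF eventually_gt_at_top[of 0]])
  obtain V where V: "\<And>m. norm (v m) \<le> V"
    using convergent_imp_Bseq[OF convergentI[OF v0]] unfolding Bseq_def by blast
  have "(\<lambda>m. \<integral>x. norm (g x - g (v m + x)) \<partial>lebesgue) \<longlonglongrightarrow> (\<integral>(x::'a). 0 \<partial>lebesgue)"
  proof (rule integral_dominated_convergence)
    \<comment> \<open>\<open>V\<close> bounds all the translations, so \<open>g\<close> and its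
      translates vanish outside the ball of radius \<open>R + V\<close>.\<close>
    show "integrable lebesgue (\<lambda>x::'a. 2 * B * indicat_real (cball 0 (R + V)) x)"
      by (rule integrable_indicator_cball)
    show "AE x in lebesgue. (\<lambda>m. norm (g x - g (v m + x))) \<longlonglongrightarrow> 0"
    proof (rule AE_I2)
      fix x
      have "(\<lambda>m. v m + x) \<longlonglongrightarrow> 0 + x"
        by (intro tendsto_intros v0)
      moreover have "isCont g x"
        using g by (simp add: continuous_on_eq_continuous_at)
      ultimately have "(\<lambda>m. g (v m + x)) \<longlonglongrightarrow> g x"
        by (intro isCont_tendsto_compose[of x g]) auto
      then have "(\<lambda>m. norm (g x - g (v m + x))) \<longlonglongrightarrow> norm (g x - g x)"
        by (intro tendsto_intros)
      then show "(\<lambda>m. norm (g x - g (v m + x))) \<longlonglongrightarrow> 0"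
        by simp
    qed
    show "AE x in lebesgue. norm (norm (g x - g (v m + x))) \<le> 2 * B * indicat_real (cball 0 (R + V)) x"
      for m
    proof (rule AE_I2)
      fix x
      show "norm (norm (g x - g (v m + x))) \<le> 2 * B * indicat_real (cball 0 (R + V)) x"
      proof (cases "norm x \<le> R + V")
        case True
        then show ?thesis
          using norm_triangle_ineq4[of "g x" "g (v m + x)"] B[of x] B[of "v m + x"] by simp
      next
        case False
        moreover have "norm x - norm (v m) \<le> norm (v m + x)"
          using norm_triangle_ineq2[of x "- v m"] by (simp add: add.commute)
        ultimately have "R < norm x" "R < norm (v m + x)"
          using V[of m] norm_ge_zero[of "v m"] by linarith+
        then show ?thesis
          using R False by simp
      qed
    qed
  qed auto
  then have "I \<longlonglongrightarrow> 0"
    using Lim_null_comparison[OF le] by simp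
  then show ?thesis
    by (simp add: I_def[abs_def])
qed

text \<open>By density of continuous functions of bounded support in L1. The exponentials have
  modulus one, so the approximation error is controlled uniformly in \<open>m\<close>.\<close>

lemma riemann_lebesgue:
  fixes f :: "'a::euclidean_space \<Rightarrow> complex"
  assumes f: "integrable lebesgue f" and "a \<noteq> 0"
  shows "(\<lambda>m. \<integral>x. f x * exp (\<i> * of_real (inner (real m *\<^sub>R a) x)) \<partial>lebesgue) \<longlonglongrightarrow> 0"
proof (rule LIMSEQ_I)
  fix e :: real assume "0 < e"
  then obtain g R where g: "continuous_on UNIV g" "\<And>x. R < norm x \<Longrightarrow> g x = 0"
    and fg: "(\<integral>x. norm (f x - g x) \<partial>lebesgue) < e / 2"
    using continuous_approximation_L1[OF f, of "e / 2"] by auto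
  let ?E = "\<lambda>m x. exp (\<i> * of_real (inner (real m *\<^sub>R a) x))"
  note [measurable] = continuous_borel_measurable_lebesgue[OF g(1)]
  have "bounded (g ` cball 0 R)"
    by (intro compact_imp_bounded compact_continuous_image continuous_on_subset[OF g(1)]) auto
  then obtain B where "\<forall>x\<in>cball 0 R. norm (g x) \<le> B"
    by (auto simp: bounded_iff)
  then have B: "norm (g x) \<le> B" if "norm x \<le> R" for x
    using that by simp
  have g_int: "integrable lebesgue g"
    by (rule integrable_bounded_support[of g "max 0 B" R])
      (use B g(2) in \<open>auto simp: le_max_iff_disj not_less[symmetric]\<close>)
  obtain N where N: "\<And>m. m \<ge> N \<Longrightarrow> norm (\<integral>x. g x * ?E m x \<partial>lebesgue) < e / 2"
  proof -
    have "(\<lambda>m. \<integral>x. g x * ?E m x \<partial>lebesgue) \<longlonglongrightarrow> 0"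
      by (rule riemann_lebesgue_continuous[of g R a]) (use g \<open>a \<noteq> 0\<close> in auto)
    from LIMSEQ_D[OF this, of "e / 2"] show ?thesis
      using \<open>0 < e\<close> that by auto
  qed
  have "norm (\<integral>x. f x * ?E m x \<partial>lebesgue) < e" if "m \<ge> N" for m
  proof -
    have i: "integrable lebesgue (\<lambda>x. f x * ?E m x)" "integrable lebesgue (\<lambda>x. g x * ?E m x)"
      by (intro integrable_mult_wave f g_int)+
    have "norm ((\<integral>x. f x * ?E m x \<partial>lebesgue) - (\<integral>x. g x * ?E m x \<partial>lebesgue)) =
        norm (\<integral>x. (f x - g x) * ?E m x \<partial>lebesgue)"
      using i by (simp add: left_diff_distrib)
    also have "\<dots> \<le> (\<integral>x. norm ((f x - g x) * ?E m x) \<partial>lebesgue)"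
      by (rule integral_norm_bound)
    also have "\<dots> < e / 2"
      using fg by (simp add: norm_mult)
    finally show ?thesis
      using N[OF that] norm_triangle_sub[of "\<integral>x. f x * ?E m x \<partial>lebesgue" "\<integral>x. g x * ?E m x \<partial>lebesgue"]
      by linarith
  qed
  then show "\<exists>N. \<forall>m\<ge>N. norm ((\<integral>x. f x * ?E m x \<partial>lebesgue) - 0) < e"
    by (intro exI[of _ N]) simp
qed

section \<open>Uniqueness of the Fourier transform\<close>

text \<open>Quantifying over all \<open>F\<close> makes this class closed under products, as the
  Stone-Weierstrass theorem requires.\<close>

definition null_multiplier :: "('a::euclidean_space \<Rightarrow> real) \<Rightarrow> bool" where
  "null_multiplier g \<longleftrightarrow> continuous_on UNIV g \<and> bounded (range g) \<and>
    (\<forall>F :: 'a \<Rightarrow> complex. integrable lebesgue F \<longrightarrow>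
      (\<forall>\<xi>. (\<integral>x. F x * exp (\<i> * of_real (inner \<xi> x)) \<partial>lebesgue) = 0) \<longrightarrow>
      (\<forall>\<xi>. (\<integral>x. F x * of_real (g x) * exp (\<i> * of_real (inner \<xi> x)) \<partial>lebesgue) = 0))"

lemma null_multiplier_continuous: "null_multiplier g \<Longrightarrow> continuous_on S g"
  unfolding null_multiplier_def by (blast intro: continuous_on_subset)

lemma null_multiplier_integrable:
  assumes "null_multiplier g" "integrable lebesgue F"
  shows "integrable lebesgue (\<lambda>x. F x * complex_of_real (g x))"
proof -
  from assms(1) obtain B where "\<And>x. norm (g x) \<le> B"
    by (auto simp: null_multiplier_def bounded_iff)
  moreover have "continuous_on UNIV (\<lambda>x. complex_of_real (g x))"
    using assms(1) by (intro continuous_intros) (simp add: null_multiplier_def)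
  ultimately show ?thesis
    by (intro integrable_mult_bounded[OF assms(2), where B = B] continuous_borel_measurable_lebesgue) auto
qed

lemma null_multiplier_add:
  fixes g h :: "'a::euclidean_space \<Rightarrow> real"
  assumes "null_multiplier g" "null_multiplier h"
  shows "null_multiplier (\<lambda>x. g x + h x)"
  unfolding null_multiplier_def
proof (intro conjI allI impI)
  fix F :: "'a \<Rightarrow> complex" and \<xi> :: 'a
  assume F: "integrable lebesgue F" "\<forall>\<xi>. (\<integral>x. F x * exp (\<i> * of_real (inner \<xi> x)) \<partial>lebesgue) = 0"
  let ?E = "\<lambda>x. exp (\<i> * of_real (inner \<xi> x))"
  have "(\<integral>x. F x * of_real (g x) * ?E x + F x * of_real (h x) * ?E x \<partial>lebesgue) =
    (\<integral>x. F x * of_real (g x) * ?E x \<partial>lebesgue) + (\<integral>x. F x * of_real (h x) * ?E x \<partial>lebesgue)"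
    by (intro Bochner_Integration.integral_add integrable_mult_wave null_multiplier_integrable assms F)
  also have "\<dots> = 0"
    using assms F unfolding null_multiplier_def by simp
  finally show "(\<integral>x. F x * of_real (g x + h x) * ?E x \<partial>lebesgue) = 0"
    by (simp add: algebra_simps)
qed (use assms in \<open>auto simp: null_multiplier_def intro!: continuous_intros bounded_plus_comp\<close>)

lemma null_multiplier_mult:
  fixes g h :: "'a::euclidean_space \<Rightarrow> real"
  assumes "null_multiplier g" "null_multiplier h"
  shows "null_multiplier (\<lambda>x. g x * h x)"
  unfolding null_multiplier_def
proof (intro conjI allI impI)
  fix F :: "'a \<Rightarrow> complex" and \<xi> :: 'a
  assume F: "integrable lebesgue F" "\<forall>\<xi>. (\<integral>x. F x * exp (\<i> * of_real (inner \<xi> x)) \<partial>lebesgue) = 0"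
  have "\<forall>\<xi>. (\<integral>x. F x * of_real (g x) * exp (\<i> * of_real (inner \<xi> x)) \<partial>lebesgue) = 0"
    using assms(1) F unfolding null_multiplier_def by simp
  \<comment> \<open>The hypothesis on \<open>h\<close> is applied to
    \<open>F x * of_real (g x)\<close> in place of \<open>F\<close>; this is where the
    quantification over all \<open>F\<close> enters.\<close>
  then have "\<forall>\<xi>. (\<integral>x. F x * of_real (g x) * of_real (h x) * exp (\<i> * of_real (inner \<xi> x)) \<partial>lebesgue) = 0"
    using assms(2) null_multiplier_integrable[OF assms(1) F(1)] unfolding null_multiplier_def by blast
  then show "(\<integral>x. F x * of_real (g x * h x) * exp (\<i> * of_real (inner \<xi> x)) \<partial>lebesgue) = 0"
    by (simp add: mult.assoc)
next
  obtain A B where AB: "\<And>x. norm (g x) \<le> A" "\<And>x. norm (h x) \<le> B"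
    using assms by (auto simp: null_multiplier_def bounded_iff)
  then have "norm (g x * h x) \<le> A * B" for x
    unfolding norm_mult using order_trans[OF norm_ge_zero AB(1)] by (intro mult_mono) auto
  then show "bounded (range (\<lambda>x. g x * h x))"
    unfolding bounded_iff by blast
qed (use assms in \<open>auto simp: null_multiplier_def intro!: continuous_intros\<close>)

lemma null_multiplier_const: "null_multiplier (\<lambda>_::'a::euclidean_space. c)"
  unfolding null_multiplier_def
proof (intro conjI allI impI)
  fix F :: "'a \<Rightarrow> complex" and \<xi> :: 'a
  assume "\<forall>\<xi>. (\<integral>x. F x * exp (\<i> * of_real (inner \<xi> x)) \<partial>lebesgue) = 0"
  then have "(\<integral>x. of_real c * (F x * exp (\<i> * of_real (inner \<xi> x))) \<partial>lebesgue) = 0"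
    by simp
  then show "(\<integral>x. F x * of_real c * exp (\<i> * of_real (inner \<xi> x)) \<partial>lebesgue) = 0"
    by (simp add: mult_ac)
qed auto

text \<open>The sine is a combination of two exponentials, which merely shift the frequency by
  \<open>\<zeta>\<close> and \<open>- \<zeta>\<close>. Being real-valued, sines fit the real
  Stone-Weierstrass theorem.\<close>

lemma null_multiplier_sin: "null_multiplier (\<lambda>x::'a::euclidean_space. sin (inner \<zeta> x))"
  unfolding null_multiplier_def
proof (intro conjI allI impI)
  fix F :: "'a \<Rightarrow> complex" and \<xi> :: 'a
  assume F: "integrable lebesgue F" "\<forall>\<xi>. (\<integral>x. F x * exp (\<i> * of_real (inner \<xi> x)) \<partial>lebesgue) = 0"
  let ?E = "\<lambda>\<xi> x. exp (\<i> * of_real (inner \<xi> x))"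
  have eq: "of_real (sin (inner \<zeta> x)) * ?E \<xi> x = (?E (\<xi> + \<zeta>) x - ?E (\<xi> - \<zeta>) x) / (2 * \<i>)" for x
  proof -
    have "?E (\<xi> + \<zeta>) x = ?E \<xi> x * ?E \<zeta> x" "?E (\<xi> - \<zeta>) x = ?E \<xi> x * exp (- (\<i> * of_real (inner \<zeta> x)))"
      by (simp_all add: inner_add_left inner_diff_left distrib_left right_diff_distrib flip: exp_add)
    then show ?thesis
      unfolding sin_of_real[symmetric] by (simp add: sin_exp_eq field_simps)
  qed
  have "(\<integral>x. F x * of_real (sin (inner \<zeta> x)) * ?E \<xi> x \<partial>lebesgue) =
    (\<integral>x. (F x * ?E (\<xi> + \<zeta>) x - F x * ?E (\<xi> - \<zeta>) x) / (2 * \<i>) \<partial>lebesgue)"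
    by (intro Bochner_Integration.integral_cong refl) (simp add: eq mult.assoc right_diff_distrib)
  also have "\<dots> = ((\<integral>x. F x * ?E (\<xi> + \<zeta>) x \<partial>lebesgue) - (\<integral>x. F x * ?E (\<xi> - \<zeta>) x \<partial>lebesgue)) / (2 * \<i>)"
    using F by (subst integral_divide_zero, subst Bochner_Integration.integral_diff)
      (auto intro!: integrable_mult_wave)
  also have "\<dots> = 0"
    using F by simp
  finally show "(\<integral>x. F x * of_real (sin (inner \<zeta> x)) * ?E \<xi> x \<partial>lebesgue) = 0" .
next
  show "bounded (range (\<lambda>x. sin (inner \<zeta> x)))"
    unfolding bounded_iff by (intro exI[of _ 1]) auto
qed (intro continuous_intros)

text \<open>\<open>\<zeta>\<close> is a multiple of \<open>x - y\<close> so small that both inner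
  products lie where the sine is injective; they differ by a positive multiple of the squared
  distance.\<close>

lemma separating_sin:
  fixes x y :: "'a::real_inner"
  assumes "x \<noteq> y"
  shows "\<exists>\<zeta>. sin (inner \<zeta> x) \<noteq> sin (inner \<zeta> y)"
proof -
  define c where "c = 1 / (1 + \<bar>inner (x - y) x\<bar> + \<bar>inner (x - y) y\<bar>)"
  have "c > 0"
    by (auto simp: c_def intro!: divide_pos_pos add_pos_nonneg)
  have "\<bar>inner (c *\<^sub>R (x - y)) x\<bar> \<le> 1" "\<bar>inner (c *\<^sub>R (x - y)) y\<bar> \<le> 1"
    by (auto simp: c_def abs_mult divide_simps)
  then have *: "\<bar>inner (c *\<^sub>R (x - y)) x\<bar> \<le> pi / 2" "\<bar>inner (c *\<^sub>R (x - y)) y\<bar> \<le> pi / 2"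
    using pi_ge_two by linarith+
  have "inner (c *\<^sub>R (x - y)) (x - y) \<noteq> 0"
    using assms \<open>c > 0\<close> by simp
  then have "inner (c *\<^sub>R (x - y)) x \<noteq> inner (c *\<^sub>R (x - y)) y"
    by (simp add: inner_diff_right)
  then show ?thesis
    using sin_inj_pi[of "inner (c *\<^sub>R (x - y)) x" "inner (c *\<^sub>R (x - y)) y"]
      abs_le_D1[OF *(1)] abs_le_D2[OF *(1)] abs_le_D1[OF *(2)] abs_le_D2[OF *(2)]
    by (intro exI[of _ "c *\<^sub>R (x - y)"]) linarith
qed

text \<open>The hypothesis makes \<open>f\<close> annihilate every multiplier. Stone-Weierstrass on
  \<open>K\<close> extends this to bounded continuous functions, and approximating the conjugate
  phase of \<open>f\<close> by such functions shows that the L1 norm vanishes.\<close>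

lemma fourier_uniqueness:
  fixes f :: "'a::euclidean_space \<Rightarrow> complex"
  assumes f: "integrable lebesgue f" and K: "compact K" "\<And>x. x \<notin> K \<Longrightarrow> f x = 0"
    and zero: "\<And>\<xi>. (\<integral>x. f x * exp (\<i> * of_real (inner \<xi> x)) \<partial>lebesgue) = 0"
  shows "AE x in lebesgue. f x = 0"
proof -
  interpret function_ring_on "Collect null_multiplier" K
  proof
    show "\<exists>g\<in>Collect null_multiplier. g x \<noteq> g y" if "x \<noteq> y" for x y :: 'a
    proof -
      obtain \<zeta> where "sin (inner \<zeta> x) \<noteq> sin (inner \<zeta> y)"
        using separating_sin[OF \<open>x \<noteq> y\<close>] by blast
      then show ?thesis
        by (intro bexI[of _ "\<lambda>x. sin (inner \<zeta> x)"]) (auto intro: null_multiplier_sin)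
    qed
  qed (use K(1) in \<open>auto intro: null_multiplier_add null_multiplier_mult null_multiplier_const
      null_multiplier_continuous\<close>)
  have zero_real: "(\<integral>x. f x * of_real (\<phi> x) \<partial>lebesgue) = 0"
    if \<phi>: "continuous_on UNIV \<phi>" "bounded (range \<phi>)" for \<phi> :: "'a \<Rightarrow> real"
  proof -
    define N where "N = (\<integral>x. norm (f x) \<partial>lebesgue)"
    have "0 \<le> N" by (simp add: N_def)
    from \<phi>(2) obtain B where B: "\<And>x. \<bar>\<phi> x\<bar> \<le> B"
      by (auto simp: bounded_iff)
    have "continuous_on UNIV (\<lambda>x. complex_of_real (\<phi> x))"
      by (intro continuous_intros \<phi>)
    then have i\<phi>: "integrable lebesgue (\<lambda>x. f x * of_real (\<phi> x))"
      using B by (intro integrable_mult_bounded[OF f, where B = B] continuous_borel_measurable_lebesgue) auto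
    have "norm (\<integral>x. f x * of_real (\<phi> x) \<partial>lebesgue) \<le> N * e" if "e > 0" for e
    proof -
      obtain g where g: "null_multiplier g" "\<And>x. x \<in> K \<Longrightarrow> \<bar>\<phi> x - g x\<bar> < e"
        using Stone_Weierstrass_basic[of \<phi> e] \<open>e > 0\<close> continuous_on_subset[OF \<phi>(1)] by auto
      have ig: "integrable lebesgue (\<lambda>x. f x * of_real (g x))"
        by (rule null_multiplier_integrable[OF g(1) f])
      \<comment> \<open>The frequency 0 turns the multiplier property into \<open>f\<close>
        annihilating \<open>g\<close>.\<close>
      have "(\<integral>x. f x * of_real (g x) * exp (\<i> * of_real (inner 0 x)) \<partial>lebesgue) = 0"
        using g(1) f zero unfolding null_multiplier_def by blast
      then have "(\<integral>x. f x * of_real (\<phi> x) \<partial>lebesgue) = (\<integral>x. f x * of_real (\<phi> x) - f x * of_real (g x) \<partial>lebesgue)"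
        using i\<phi> ig by simp
      also have "norm \<dots> \<le> (\<integral>x. norm (f x * of_real (\<phi> x) - f x * of_real (g x)) \<partial>lebesgue)"
        by (rule integral_norm_bound)
      also have "\<dots> \<le> (\<integral>x. norm (f x) * e \<partial>lebesgue)"
      proof (rule integral_mono)
        show "norm (f x * of_real (\<phi> x) - f x * of_real (g x)) \<le> norm (f x) * e" for x
        proof (cases "x \<in> K")
          case True
          have "norm (f x * of_real (\<phi> x) - f x * of_real (g x)) = norm (f x) * \<bar>\<phi> x - g x\<bar>"
            by (metis norm_mult norm_of_real of_real_diff right_diff_distrib)
          then show ?thesis
            using g(2)[OF True] by (simp add: mult_left_mono)
        qed (use K \<open>e > 0\<close> in auto)
      qed (use f i\<phi> ig in auto)
      finally show ?thesis
        by (simp add: N_def)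
    qed
    then have "norm (\<integral>x. f x * of_real (\<phi> x) \<partial>lebesgue) \<le> 0 + e" if "e > 0" for e
    proof -
      \<comment> \<open>Dividing by \<open>N + 1\<close> covers the case
        \<open>N = 0\<close>.\<close>
      have "N * (e / (N + 1)) \<le> e"
        using \<open>0 \<le> N\<close> that by (simp add: field_simps)
      moreover have "norm (\<integral>x. f x * of_real (\<phi> x) \<partial>lebesgue) \<le> N * (e / (N + 1))"
        using \<open>0 \<le> N\<close> that \<open>\<And>e. e > 0 \<Longrightarrow> norm _ \<le> N * e\<close>[of "e / (N + 1)"] by simp
      ultimately show ?thesis by simp
    qed
    then have "norm (\<integral>x. f x * of_real (\<phi> x) \<partial>lebesgue) \<le> 0"
      by (rule field_le_epsilon)
    then show ?thesis by simp
  qed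
  have zero_cont: "(\<integral>x. f x * g x \<partial>lebesgue) = 0"
    if g: "continuous_on UNIV g" "\<And>x. norm (g x) \<le> 1" for g :: "'a \<Rightarrow> complex"
  proof -
    have R: "continuous_on UNIV (\<lambda>x. Re (g x))" "bounded (range (\<lambda>x. Re (g x)))"
      and I: "continuous_on UNIV (\<lambda>x. Im (g x))" "bounded (range (\<lambda>x. Im (g x)))"
      using g(1) order_trans[OF abs_Re_le_cmod g(2)] order_trans[OF abs_Im_le_cmod g(2)]
      by (auto simp: bounded_iff intro!: continuous_intros exI[of _ 1])
    have c: "continuous_on UNIV (\<lambda>x. complex_of_real (Re (g x)))" "continuous_on UNIV (\<lambda>x. complex_of_real (Im (g x)))"
      by (intro continuous_intros R I)+
    have i: "integrable lebesgue (\<lambda>x. f x * of_real (Re (g x)))" "integrable lebesgue (\<lambda>x. f x * of_real (Im (g x)))"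
      using c order_trans[OF abs_Re_le_cmod g(2)] order_trans[OF abs_Im_le_cmod g(2)]
      by (auto intro!: integrable_mult_bounded[OF f, where B = 1] continuous_borel_measurable_lebesgue)
    have "(\<integral>x. f x * g x \<partial>lebesgue) =
      (\<integral>x. f x * of_real (Re (g x)) + \<i> * (f x * of_real (Im (g x))) \<partial>lebesgue)"
      by (intro Bochner_Integration.integral_cong refl)
        (subst complex_eq, simp add: distrib_left mult_ac)
    also have "\<dots> = 0"
      using i zero_real[OF R] zero_real[OF I] by simp
    finally show ?thesis .
  qed
  have [measurable]: "f \<in> borel_measurable lebesgue"
    using f by auto
  \<comment> \<open>The conjugate phase of \<open>f\<close>. Where \<open>f x = 0\<close>, division
    by zero gives \<open>s x = 0\<close>, so the bound 1 and the identity
    \<open>f x * s x = of_real (norm (f x))\<close> hold everywhere.\<close>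
  define s where "s x = cnj (f x) / of_real (norm (f x))" for x
  have s_meas: "s \<in> borel_measurable lebesgue"
  proof -
    have "cnj \<in> borel_measurable borel" "(of_real :: real \<Rightarrow> complex) \<in> borel_measurable borel"
      by (intro borel_measurable_continuous_onI continuous_intros)+
    then have "(\<lambda>x. cnj (f x)) \<in> borel_measurable lebesgue"
        "(\<lambda>x. complex_of_real (norm (f x))) \<in> borel_measurable lebesgue"
      by measurable
    then show ?thesis
      unfolding s_def[abs_def] by (rule borel_measurable_divide)
  qed
  have s_le: "norm (s x) \<le> 1" for x
    by (simp add: s_def norm_divide)
  from bounded_continuous_approximation[OF s_meas s_le] obtain g :: "nat \<Rightarrow> 'a \<Rightarrow> complex"
    where g: "\<And>n. continuous_on UNIV (g n)" "\<And>n x. norm (g n x) \<le> 1"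
      "AE x in lebesgue. (\<lambda>n. g n x) \<longlonglongrightarrow> s x" by blast
  note [measurable] = s_meas continuous_borel_measurable_lebesgue[OF g(1)]
  have "(\<lambda>n. \<integral>x. f x * g n x \<partial>lebesgue) \<longlonglongrightarrow> (\<integral>x. f x * s x \<partial>lebesgue)"
  proof (rule integral_dominated_convergence)
    show "integrable lebesgue (\<lambda>x. norm (f x))"
      using f by simp
    show "AE x in lebesgue. (\<lambda>n. f x * g n x) \<longlonglongrightarrow> f x * s x"
      using g(3) by eventually_elim (intro tendsto_intros)
    show "AE x in lebesgue. norm (f x * g n x) \<le> norm (f x)" for n
      using g(2) by (auto simp: norm_mult intro!: mult_left_le)
  qed measurable
  then have "(\<integral>x. f x * s x \<partial>lebesgue) = 0"
    using zero_cont[OF g(1,2)] by (simp add: LIMSEQ_const_iff)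
  moreover have "f x * s x = of_real (norm (f x))" for x
  proof (cases "f x = 0")
    case False
    have "f x * s x = of_real ((norm (f x))\<^sup>2) / of_real (norm (f x))"
      using complex_norm_square[of "f x"] by (simp add: s_def)
    then show ?thesis
      using False by (simp add: power2_eq_square)
  qed simp
  ultimately have "(\<integral>x. norm (f x) \<partial>lebesgue) = 0"
    by simp
  then show ?thesis
    using integral_nonneg_eq_0_iff_AE[OF integrable_norm[OF f]] by simp
qed

section \<open>Plane waves in the Helmholtz space\<close>

text \<open>Agreement with the exponential is required on the open set only, since elements of the
  Helmholtz space are zero outside it. The constant \<open>c\<close> lets the lemma apply again to
  partial derivatives.\<close>

lemma has_derivative_exp_on_open:
  fixes L :: "'a::euclidean_space \<Rightarrow> complex"
  assumes "open \<Omega>" "bounded_linear L" and w: "\<And>x. x \<in> \<Omega> \<Longrightarrow> w x = c * exp (L x)" and x: "x \<in> \<Omega>"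
  shows "(w has_derivative (\<lambda>h. c * (exp (L x) * L h))) (at x)"
proof (rule has_derivative_transform_within_open[OF _ \<open>open \<Omega>\<close> x])
  have "(exp has_derivative (*) (exp (L x))) (at (L x))"
    using DERIV_exp by (rule has_field_derivative_imp_has_derivative)
  from has_derivative_compose[OF bounded_linear.has_derivative[OF assms(2) has_derivative_ident] this]
  show "((\<lambda>x. c * exp (L x)) has_derivative (\<lambda>h. c * (exp (L x) * L h))) (at x)"
    by (intro has_derivative_mult_right)
qed (use w in auto)

lemma partial_deriv_exp_on_open:
  fixes L :: "'a::euclidean_space \<Rightarrow> complex"
  assumes "open \<Omega>" "bounded_linear L" "\<And>x. x \<in> \<Omega> \<Longrightarrow> w x = c * exp (L x)" "x \<in> \<Omega>"
  shows "partial_deriv b w x = (c * L b) * exp (L x)"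
  unfolding partial_deriv_def
  using fun_cong[OF frechet_derivative_at[OF has_derivative_exp_on_open[OF assms]], of b, symmetric]
  by (simp only: mult.commute[of "L b"] mult.assoc)

text \<open>Differentiating twice along \<open>b\<close> multiplies the wave by the square of
  \<open>L b\<close>, so \<open>char\<close> yields the Helmholtz equation. On a bounded set the
  exponential is bounded, hence square integrable.\<close>

lemma exp_linear_in_helmholtz_space:
  fixes L :: "'a::euclidean_space \<Rightarrow> complex"
  assumes "open \<Omega>" "bounded \<Omega>" and L: "bounded_linear L"
    and char: "(\<Sum>b\<in>Basis. (L b)\<^sup>2) = - of_real (k\<^sup>2)"
  shows "(\<lambda>x. if x \<in> \<Omega> then exp (L x) else 0) \<in> helmholtz_space k \<Omega>"
proof -
  define u where "u x = (if x \<in> \<Omega> then exp (L x) else 0)" for x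
  have u: "u x = 1 * exp (L x)" if "x \<in> \<Omega>" for x
    using that by (simp add: u_def)
  have p1: "partial_deriv b u x = (1 * L b) * exp (L x)" if "x \<in> \<Omega>" for b x
    using partial_deriv_exp_on_open[OF \<open>open \<Omega>\<close> L u that] .
  have p2: "partial_deriv c (partial_deriv b u) x = (1 * L b * L c) * exp (L x)"
    if "x \<in> \<Omega>" for b c x
    using partial_deriv_exp_on_open[OF \<open>open \<Omega>\<close> L p1 that] .
  have L_cont: "continuous_on S L" for S
    by (rule linear_continuous_on[OF L])
  have "C2_on \<Omega> u"
    unfolding C2_on_def
  proof (intro conjI ballI)
    show "u differentiable at x" if "x \<in> \<Omega>" for x
      using has_derivative_exp_on_open[OF \<open>open \<Omega>\<close> L u that] by (rule differentiableI)
    show "partial_deriv b u differentiable at x" if "x \<in> \<Omega>" for b x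
      using has_derivative_exp_on_open[OF \<open>open \<Omega>\<close> L p1 that] by (rule differentiableI)
    show "continuous_on \<Omega> (partial_deriv c (partial_deriv b u))" for b c
      by (subst continuous_on_cong[OF refl p2]) (auto intro!: continuous_intros L_cont)
  qed
  moreover have "laplacian u x + of_real (k\<^sup>2) * u x = 0" if "x \<in> \<Omega>" for x
  proof -
    have "laplacian u x = (\<Sum>b\<in>Basis. (L b)\<^sup>2) * exp (L x)"
      unfolding laplacian_def sum_distrib_right
      by (intro sum.cong refl) (simp add: p2[OF that] power2_eq_square)
    then show ?thesis
      using that unfolding char by (simp add: u_def)
  qed
  moreover have "set_integrable lebesgue \<Omega> (\<lambda>x. (cmod (u x))\<^sup>2)"
    unfolding set_integrable_def
  proof -
    obtain R where R: "\<And>x. x \<in> \<Omega> \<Longrightarrow> norm x \<le> R"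
      using \<open>bounded \<Omega>\<close> by (auto simp: bounded_iff)
    obtain C where C: "0 < C" "\<And>x. norm (L x) \<le> norm x * C"
      using bounded_linear.pos_bounded[OF L] by auto
    have eq: "indicat_real \<Omega> x *\<^sub>R (cmod (u x))\<^sup>2 = indicat_real \<Omega> x *\<^sub>R (cmod (exp (L x)))\<^sup>2" for x
      by (simp add: u_def indicator_def)
    have "(\<lambda>x. indicat_real \<Omega> x *\<^sub>R (cmod (exp (L x)))\<^sup>2) \<in> borel_measurable lebesgue"
      using \<open>open \<Omega>\<close> by (intro borel_measurable_scaleR borel_measurable_indicator
          continuous_borel_measurable_lebesgue) (auto intro!: continuous_intros L_cont)
    then show "integrable lebesgue (\<lambda>x. indicat_real \<Omega> x *\<^sub>R (cmod (u x))\<^sup>2)"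
      unfolding eq
    proof (rule integrable_bounded_support[where B = "(exp (R * C))\<^sup>2" and R = R])
      show "norm (indicat_real \<Omega> x *\<^sub>R (cmod (exp (L x)))\<^sup>2) \<le> (exp (R * C))\<^sup>2" for x
      proof (cases "x \<in> \<Omega>")
        case True
        have "cmod (exp (L x)) \<le> exp (norm (L x))"
          by (rule norm_exp)
        also have "\<dots> \<le> exp (R * C)"
          using order_trans[OF C(2)[of x] mult_right_mono[OF R[OF True], of C]] C(1) by simp
        finally show ?thesis
          using True by (simp add: power_mono del: norm_exp_eq_Re)
      qed simp
      show "indicat_real \<Omega> x *\<^sub>R (cmod (exp (L x)))\<^sup>2 = 0" if "R < norm x" for x
        using R[of x] that by (auto simp: indicator_def)
    qed
  qed
  ultimately show ?thesis
    unfolding helmholtz_space_def u_def[abs_def, symmetric] by (auto simp: u_def)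
qed

section \<open>Finite rank as separation of variables in the form\<close>

lemma helmholtz_space_measurable:
  assumes "open \<Omega>" "u \<in> helmholtz_space k \<Omega>"
  shows "u \<in> borel_measurable lebesgue"
proof -
  have "continuous_on \<Omega> u"
    using assms unfolding helmholtz_space_def C2_on_def
    by (auto intro!: continuous_at_imp_continuous_on differentiable_imp_continuous_within)
  then have "(\<lambda>x. indicator \<Omega> x *\<^sub>R u x) \<in> borel_measurable borel"
    using \<open>open \<Omega>\<close> by (intro borel_measurable_continuous_on_indicator) auto
  also have "(\<lambda>x. indicator \<Omega> x *\<^sub>R u x) = u"
    using assms(2) by (auto simp: helmholtz_space_def indicator_def fun_eq_iff)
  finally show ?thesis
    by (simp add: measurable_completion)
qed

lemma helmholtz_space_product_integrable:
  assumes "open \<Omega>" and u: "u \<in> helmholtz_space k \<Omega>" and v: "v \<in> helmholtz_space k \<Omega>"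
  shows "set_integrable lebesgue \<Omega> (\<lambda>x. u x * cnj (v x))"
  unfolding set_integrable_def
proof (rule Bochner_Integration.integrable_bound)
  have [measurable]: "u \<in> borel_measurable lebesgue" "v \<in> borel_measurable lebesgue"
    using helmholtz_space_measurable assms by blast+
  have [measurable]: "cnj \<in> borel_measurable borel"
    by (intro borel_measurable_continuous_onI continuous_intros)
  have [measurable]: "\<Omega> \<in> sets lebesgue"
    using \<open>open \<Omega>\<close> by auto
  have "(\<lambda>x. cnj (v x)) \<in> borel_measurable lebesgue"
    by measurable
  then show "(\<lambda>x. indicat_real \<Omega> x *\<^sub>R (u x * cnj (v x))) \<in> borel_measurable lebesgue"
    by measurable
  show "integrable lebesgue
      (\<lambda>x. indicat_real \<Omega> x *\<^sub>R (cmod (u x))\<^sup>2 + indicat_real \<Omega> x *\<^sub>R (cmod (v x))\<^sup>2)"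
    using u v unfolding helmholtz_space_def set_integrable_def
    by (intro Bochner_Integration.integrable_add) auto
  show "AE x in lebesgue. norm (indicat_real \<Omega> x *\<^sub>R (u x * cnj (v x))) \<le>
      norm (indicat_real \<Omega> x *\<^sub>R (cmod (u x))\<^sup>2 + indicat_real \<Omega> x *\<^sub>R (cmod (v x))\<^sup>2)"
  proof (rule AE_I2)
    fix x
    have "0 \<le> (cmod (u x) - cmod (v x))\<^sup>2" "0 \<le> (cmod (u x))\<^sup>2" "0 \<le> (cmod (v x))\<^sup>2"
      by simp_all
    then have "cmod (u x) * cmod (v x) \<le> (cmod (u x))\<^sup>2 + (cmod (v x))\<^sup>2"
      unfolding power2_diff by linarith
    then show "norm (indicat_real \<Omega> x *\<^sub>R (u x * cnj (v x))) \<le>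
        norm (indicat_real \<Omega> x *\<^sub>R (cmod (u x))\<^sup>2 + indicat_real \<Omega> x *\<^sub>R (cmod (v x))\<^sup>2)"
      by (auto simp: indicator_def norm_mult)
  qed
qed

text \<open>The coefficients of \<open>T (u t)\<close> over \<open>B\<close> depend on
  \<open>t\<close> only and the inner products with \<open>v s\<close> on \<open>s\<close> only.
  Integrability of products within the space lets the finite sum leave the integral.\<close>

lemma finite_rank_toeplitz_form:
  assumes "open \<Omega>" and T: "is_toeplitz_operator k \<Omega> F T"
    and rank: "finite_rank_on (helmholtz_space k \<Omega>) T"
    and u: "\<And>t. u t \<in> helmholtz_space k \<Omega>" and v: "\<And>s. v s \<in> helmholtz_space k \<Omega>"
  shows "\<exists>n (c :: nat \<Rightarrow> _) b. \<forall>t s. toeplitz_form \<Omega> F (u t) (v s) = (\<Sum>j<n. c j t * b j s)"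
proof -
  from rank obtain B where B: "finite B" "B \<subseteq> helmholtz_space k \<Omega>"
    and "\<And>w. w \<in> helmholtz_space k \<Omega> \<Longrightarrow> \<exists>c. T w = (\<lambda>x. \<Sum>b\<in>B. c b * b x)"
    unfolding finite_rank_on_def by blast
  then have "\<exists>c. \<forall>t. T (u t) = (\<lambda>x. \<Sum>b\<in>B. c t b * b x)"
    using u by (intro choice) blast
  then obtain c where c: "\<And>t. T (u t) = (\<lambda>x. \<Sum>b\<in>B. c t b * b x)"
    by blast
  have form: "toeplitz_form \<Omega> F (u t) (v s) = (\<Sum>b\<in>B. c t b * L2_inner \<Omega> b (v s))" for t s
  proof -
    have i: "integrable lebesgue (\<lambda>x. indicat_real \<Omega> x *\<^sub>R (b x * cnj (v s x)))" if "b \<in> B" for b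
      using helmholtz_space_product_integrable[OF \<open>open \<Omega>\<close> _ v] that B(2)
      unfolding set_integrable_def by blast
    have "toeplitz_form \<Omega> F (u t) (v s) = L2_inner \<Omega> (T (u t)) (v s)"
      using T u v by (simp add: is_toeplitz_operator_def)
    also have "\<dots> = (\<integral>x. (\<Sum>b\<in>B. c t b * (indicat_real \<Omega> x *\<^sub>R (b x * cnj (v s x)))) \<partial>lebesgue)"
      unfolding L2_inner_def set_lebesgue_integral_def c
      by (intro Bochner_Integration.integral_cong refl)
        (simp add: sum_distrib_right scaleR_sum_right mult.assoc)
    also have "\<dots> = (\<Sum>b\<in>B. \<integral>x. c t b * (indicat_real \<Omega> x *\<^sub>R (b x * cnj (v s x))) \<partial>lebesgue)"
      by (intro Bochner_Integration.integral_sum integrable_mult_right i)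
    also have "\<dots> = (\<Sum>b\<in>B. c t b * L2_inner \<Omega> b (v s))"
      unfolding L2_inner_def set_lebesgue_integral_def
      by (intro sum.cong refl integral_mult_right_zero)
    finally show ?thesis .
  qed
  obtain g where g: "bij_betw g {0..<card B} B"
    using ex_bij_betw_nat_finite[OF B(1)] by blast
  have "toeplitz_form \<Omega> F (u t) (v s) = (\<Sum>j<card B. c t (g j) * L2_inner \<Omega> (g j) (v s))" for t s
    unfolding form lessThan_atLeast0 by (rule sum.reindex_bij_betw[OF g, symmetric])
  then show ?thesis
    by (intro exI[of _ "card B"] exI[of _ "\<lambda>j t. c t (g j)"] exI[of _ "\<lambda>j s. L2_inner \<Omega> (g j) (v s)"]) simp
qed

section \<open>From plane waves to the Fourier transform on lines\<close>

text \<open>This is the bilinear, not the Hermitian, square of i (k e + t (a + i b)). The vector a +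
  i b has square zero and is orthogonal to \<open>e\<close>, so only the contribution of k e
  survives.\<close>

lemma orthonormal_isotropic_sum:
  fixes a b e :: "'a::euclidean_space"
  assumes on: "inner a a = 1" "inner b b = 1" "inner e e = 1"
    "inner a b = 0" "inner a e = 0" "inner b e = 0"
  shows "(\<Sum>c\<in>Basis. (\<i> * (of_real (k * inner e c) + t * Complex (inner a c) (inner b c)))\<^sup>2)
    = - of_real (k\<^sup>2)"
proof -
  have ip: "(\<Sum>c\<in>Basis. complex_of_real (inner x c) * of_real (inner y c)) = of_real (inner x y)"
    for x y :: 'a
    unfolding euclidean_inner[of x y] by simp
  have "(\<i> * (of_real (k * inner e c) + t * Complex (inner a c) (inner b c)))\<^sup>2 =
    - (of_real (k\<^sup>2) * (of_real (inner e c) * of_real (inner e c)) +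
       t\<^sup>2 * (of_real (inner a c) * of_real (inner a c)) - t\<^sup>2 * (of_real (inner b c) * of_real (inner b c)) +
       2 * \<i> * t\<^sup>2 * (of_real (inner a c) * of_real (inner b c)) +
       2 * of_real k * t * (of_real (inner a c) * of_real (inner e c)) +
       2 * \<i> * of_real k * t * (of_real (inner b c) * of_real (inner e c)))" for c
    unfolding Complex_eq by (simp add: power2_eq_square algebra_simps)
  then show ?thesis
    by (simp only: sum_negf sum.distrib sum_subtractf sum_distrib_left[symmetric] ip on) simp
qed

text \<open>The line is spanned by \<open>a\<close>; \<open>b\<close> supplies the imaginary part of
  \<open>z\<close>, and \<open>e\<close> carries the frequency \<open>k\<close>, which cancels in
  the form. The resulting kernel \<open>h\<close> satisfies the hypotheses of
  \<open>finite_rank_kernel_vanishes\<close>.\<close>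

lemma fourier_vanishes_on_line:
  fixes F :: "'a::euclidean_space \<Rightarrow> complex"
  assumes "open \<Omega>" "bounded \<Omega>"
    and F: "set_integrable lebesgue \<Omega> F"
    and K: "compact K" "AE x in lebesgue. x \<in> \<Omega> - K \<longrightarrow> F x = 0"
    and T: "is_toeplitz_operator k \<Omega> F T" "finite_rank_on (helmholtz_space k \<Omega>) T"
    and on: "inner a a = 1" "inner b b = 1" "inner e e = 1"
      "inner a b = 0" "inner a e = 0" "inner b e = 0"
    and f_def: "\<And>x. f x = indicat_real K x *\<^sub>R (indicat_real \<Omega> x *\<^sub>R F x)"
  shows "(\<integral>x. f x * exp (\<i> * of_real (inner (r *\<^sub>R a) x)) \<partial>lebesgue) = 0"
proof -
  define z where "z x = Complex (inner a x) (inner b x)" for x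
  have z_cont: "continuous_on UNIV z"
    unfolding z_def Complex_eq by (intro continuous_intros)
  have F_int: "integrable lebesgue (\<lambda>x. indicat_real \<Omega> x *\<^sub>R F x)"
    using F by (simp add: set_integrable_def)
  have f_int: "integrable lebesgue f"
    unfolding f_def[abs_def]
    by (rule integrable_mult_indicator[OF _ F_int]) (use K(1) in \<open>auto simp: borel_compact\<close>)
  have fK: "x \<in> K" if "f x \<noteq> 0" for x
    using that by (auto simp: f_def indicator_def split: if_splits)
  have f_AE: "AE x in lebesgue. indicat_real \<Omega> x *\<^sub>R F x = f x"
    using K(2) by eventually_elim (auto simp: f_def indicator_def)
  have "bounded (z ` K)"
    by (intro compact_imp_bounded compact_continuous_image continuous_on_subset[OF z_cont] K) auto
  then obtain Z where "\<forall>x\<in>K. norm (z x) \<le> Z"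
    by (auto simp: bounded_iff)
  then have Z: "norm (z x) \<le> Z" if "f x \<noteq> 0" for x
    using fK[OF that] by blast
  define h where "h t s = (\<integral>x. f x * exp (\<i> * (t * z x + s * cnj (z x))) \<partial>lebesgue)" for t s

  have weight_int: "integrable lebesgue (\<lambda>x. f x * exp (\<i> * (t * z x + s * cnj (z x))))" for t s
  proof (rule integrable_mult_bounded[OF f_int])
    show "(\<lambda>x. exp (\<i> * (t * z x + s * cnj (z x)))) \<in> borel_measurable lebesgue"
      by (intro continuous_borel_measurable_lebesgue continuous_intros z_cont)
    show "norm (exp (\<i> * (t * z x + s * cnj (z x)))) \<le> exp ((norm t + norm s) * Z)" if "f x \<noteq> 0" for x
    proof -
      have "norm (exp (\<i> * (t * z x + s * cnj (z x)))) \<le> exp (norm (\<i> * (t * z x + s * cnj (z x))))"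
        by (rule norm_exp)
      also have "norm (\<i> * (t * z x + s * cnj (z x))) \<le> norm t * norm (z x) + norm s * norm (z x)"
        using norm_triangle_ineq[of "t * z x" "s * cnj (z x)"] by (simp add: norm_mult)
      also have "\<dots> \<le> (norm t + norm s) * Z"
        using Z[OF that] by (simp add: distrib_right[symmetric] mult_left_mono)
      finally show ?thesis by simp
    qed
  qed

  define L where "L t x = \<i> * (of_real (k * inner e x) + t * z x)" for t x
  define u where "u t x = (if x \<in> \<Omega> then exp (L t x) else 0)" for t x
  have u_mem: "u t \<in> helmholtz_space k \<Omega>" for t
    unfolding u_def[abs_def]
  proof (rule exp_linear_in_helmholtz_space[OF \<open>open \<Omega>\<close> \<open>bounded \<Omega>\<close>])
    have "linear (L t)"
      by (rule linearI) (auto simp: L_def z_def inner_add_right Complex_eq algebra_simps scaleR_conv_of_real)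
    then show "bounded_linear (L t)"
      by (rule linear_conv_bounded_linear[THEN iffD1])
    show "(\<Sum>c\<in>Basis. (L t c)\<^sup>2) = - of_real (k\<^sup>2)"
      unfolding L_def z_def by (rule orthonormal_isotropic_sum[OF on])
  qed
  \<comment> \<open>The parameter \<open>- cnj s\<close> undoes the conjugation of the second
    argument, so that \<open>h\<close> is holomorphic in \<open>s\<close> rather than
    antiholomorphic.\<close>
  have form: "toeplitz_form \<Omega> F (u t) (u (- cnj s)) = h t s" for t s
  proof -
    have "L t x + cnj (L (- cnj s) x) = \<i> * (t * z x + s * cnj (z x))" for x
      by (simp add: L_def algebra_simps)
    then have "indicat_real \<Omega> x *\<^sub>R (F x * u t x * cnj (u (- cnj s) x)) =
      (indicat_real \<Omega> x *\<^sub>R F x) * exp (\<i> * (t * z x + s * cnj (z x)))" for x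
      by (simp add: u_def exp_cnj mult.assoc flip: exp_add)
    then have "toeplitz_form \<Omega> F (u t) (u (- cnj s)) =
      (\<integral>x. (indicat_real \<Omega> x *\<^sub>R F x) * exp (\<i> * (t * z x + s * cnj (z x))) \<partial>lebesgue)"
      unfolding toeplitz_form_def set_lebesgue_integral_def by (simp only:)
    also have "\<dots> = h t s"
      unfolding h_def
    proof (rule integral_cong_AE)
      have "(\<lambda>x. exp (\<i> * (t * z x + s * cnj (z x)))) \<in> borel_measurable lebesgue"
        by (intro continuous_borel_measurable_lebesgue continuous_intros z_cont)
      then show "(\<lambda>x. (indicat_real \<Omega> x *\<^sub>R F x) * exp (\<i> * (t * z x + s * cnj (z x)))) \<in> borel_measurable lebesgue"
        using F_int by (intro borel_measurable_times) auto
      show "(\<lambda>x. f x * exp (\<i> * (t * z x + s * cnj (z x)))) \<in> borel_measurable lebesgue"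
        using weight_int by auto
      show "AE x in lebesgue. (indicat_real \<Omega> x *\<^sub>R F x) * exp (\<i> * (t * z x + s * cnj (z x))) =
          f x * exp (\<i> * (t * z x + s * cnj (z x)))"
        using f_AE by eventually_elim simp
    qed
    finally show ?thesis .
  qed
  obtain n :: nat and c b' where rank: "\<And>t s. h t s = (\<Sum>j<n. c j t * b' j s)"
    using finite_rank_toeplitz_form[OF \<open>open \<Omega>\<close> T u_mem u_mem, of "\<lambda>t. t" "\<lambda>s. - cnj s"]
    unfolding form by blast

  have hol1: "(\<lambda>t. h t s) holomorphic_on UNIV" for s
  proof -
    \<comment> \<open>The factor independent of \<open>t\<close> joins \<open>f\<close> as the
      integrable weight; the term \<open>0 * z x\<close> brings it into the form of
      \<open>weight_int\<close>.\<close>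
    have "(\<lambda>t. \<integral>x. f x * exp (\<i> * (0 * z x + s * cnj (z x))) * exp (t * (\<i> * z x)) \<partial>lebesgue) holomorphic_on UNIV"
    proof (rule holomorphic_exp_transform[OF weight_int])
      show "(\<lambda>x. \<i> * z x) \<in> borel_measurable lebesgue"
        by (intro continuous_borel_measurable_lebesgue continuous_intros z_cont)
    qed (use Z in \<open>auto simp: norm_mult\<close>)
    then show ?thesis
      unfolding h_def by (simp add: mult.assoc distrib_left mult_ac flip: exp_add)
  qed
  have hol2: "(\<lambda>s. h t s) holomorphic_on UNIV" for t
  proof -
    have "(\<lambda>s. \<integral>x. f x * exp (\<i> * (t * z x + 0 * cnj (z x))) * exp (s * (\<i> * cnj (z x))) \<partial>lebesgue) holomorphic_on UNIV"
    proof (rule holomorphic_exp_transform[OF weight_int])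
      show "(\<lambda>x. \<i> * cnj (z x)) \<in> borel_measurable lebesgue"
        by (intro continuous_borel_measurable_lebesgue continuous_intros z_cont)
    qed (use Z in \<open>auto simp: norm_mult\<close>)
    then show ?thesis
      unfolding h_def by (simp add: mult.assoc distrib_left mult_ac flip: exp_add)
  qed
  \<comment> \<open>For \<open>s = cnj t\<close> the phase \<open>t * z x + s * cnj (z x)\<close> is
    real, so the exponential in \<open>t\<close> has modulus one; the shifts \<open>t0\<close> and
    \<open>s0\<close> go into the weight.\<close>
  have h_shift: "h (t + t0) (cnj t + s0) =
      (\<integral>x. f x * exp (\<i> * (t0 * z x + s0 * cnj (z x))) * exp (\<i> * of_real (2 * Re (t * z x))) \<partial>lebesgue)"
    for t t0 s0
  proof -
    have "\<i> * ((t + t0) * z x + (cnj t + s0) * cnj (z x)) =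
      \<i> * (t0 * z x + s0 * cnj (z x)) + \<i> * (t * z x + cnj (t * z x))" for x
      by (simp add: algebra_simps)
    then have "\<i> * ((t + t0) * z x + (cnj t + s0) * cnj (z x)) =
      \<i> * (t0 * z x + s0 * cnj (z x)) + \<i> * of_real (2 * Re (t * z x))" for x
      unfolding complex_add_cnj .
    then show ?thesis
      unfolding h_def by (simp only: exp_add mult.assoc)
  qed
  have bdd: "\<exists>M. \<forall>t. norm (h (t + t0) (cnj t + s0)) \<le> M" for t0 s0
  proof (intro exI allI)
    fix t
    have "norm (h (t + t0) (cnj t + s0)) \<le>
      (\<integral>x. norm (f x * exp (\<i> * (t0 * z x + s0 * cnj (z x))) * exp (\<i> * of_real (2 * Re (t * z x)))) \<partial>lebesgue)"
      unfolding h_shift by (rule integral_norm_bound)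
    also have "\<dots> = (\<integral>x. norm (f x * exp (\<i> * (t0 * z x + s0 * cnj (z x)))) \<partial>lebesgue)"
      by (simp only: norm_mult norm_exp_i_times mult_1_right)
    finally show "norm (h (t + t0) (cnj t + s0)) \<le>
        (\<integral>x. norm (f x * exp (\<i> * (t0 * z x + s0 * cnj (z x)))) \<partial>lebesgue)" .
  qed
  have lim: "(\<lambda>m. h (of_nat m + t0) (of_nat m + s0)) \<longlonglongrightarrow> 0" for t0 s0
  proof -
    \<comment> \<open>Since \<open>Re (z x)\<close> is \<open>inner a x\<close>, the phase at
      \<open>t = of_nat m\<close> has frequency \<open>m\<close> times
      \<open>2 *\<^sub>R a\<close>.\<close>
    have "2 *\<^sub>R a \<noteq> 0"
      using on(1) by auto
    from riemann_lebesgue[OF weight_int[of t0 s0] this]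
    have "(\<lambda>m. \<integral>x. f x * exp (\<i> * (t0 * z x + s0 * cnj (z x))) *
        exp (\<i> * of_real (2 * Re (of_nat m * z x))) \<partial>lebesgue) \<longlonglongrightarrow> 0"
      by (simp add: z_def mult_ac)
    then show ?thesis
      unfolding h_shift[symmetric] by simp
  qed
  \<comment> \<open>The halves compensate for \<open>z x + cnj (z x)\<close> being twice
    \<open>inner a x\<close>.\<close>
  have "h (of_real (r / 2)) (of_real (r / 2)) = 0"
    by (rule finite_rank_kernel_vanishes[OF hol1 hol2 bdd lim rank])
  moreover have "of_real (r / 2) * z x + of_real (r / 2) * cnj (z x) = of_real (inner (r *\<^sub>R a) x)" for x
    by (simp add: z_def Complex_eq algebra_simps)
  ultimately show ?thesis
    by (simp add: h_def)
qed

text \<open>Spans of one and of two vectors are proper subspaces in dimension at least three, so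
  orthogonal vectors supply \<open>b\<close> and then \<open>e\<close>. For \<open>\<xi> = 0\<close>
  a basis vector serves as \<open>a\<close>, with \<open>r = 0\<close>.\<close>

lemma orthonormal_triple_containing_direction:
  fixes \<xi> :: "'a::euclidean_space"
  assumes "DIM('a) \<ge> 3"
  obtains r a b e where "\<xi> = r *\<^sub>R a" "inner a a = 1" "inner b b = 1" "inner e e = 1"
    "inner a b = 0" "inner a e = 0" "inner b e = 0"
proof -
  have normalise: "inner (x /\<^sub>R norm x) (x /\<^sub>R norm x) = 1" if "x \<noteq> 0" for x :: 'a
    using that by (simp add: dot_square_norm power2_eq_square)
  obtain r a where ra: "\<xi> = r *\<^sub>R a" "inner a a = 1"
  proof (cases "\<xi> = 0")
    case True
    then show ?thesis
      using that[of 0 "SOME i. i \<in> Basis"] by (simp add: some_in_eq)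
  next
    case False
    then show ?thesis
      using that[of "norm \<xi>" "\<xi> /\<^sub>R norm \<xi>"] normalise by simp
  qed
  have "dim {a} < DIM('a)"
    using assms by (intro le_less_trans[OF dim_le_card']) auto
  then obtain y where y: "y \<noteq> 0" "\<And>w. w \<in> span {a} \<Longrightarrow> inner y w = 0"
    unfolding Linear_Algebra.real_inner_class.orthogonal_def[symmetric]
    by (rule orthogonal_to_subspace_exists) blast
  define b where "b = y /\<^sub>R norm y"
  have "dim {a, b} \<le> card {a, b}"
    by (rule dim_le_card') simp
  also have "\<dots> < DIM('a)"
    using assms card_insert_le_m1[of 2 "{b}" a] by auto
  finally obtain w where w: "w \<noteq> 0" "\<And>x. x \<in> span {a, b} \<Longrightarrow> inner w x = 0"
    unfolding Linear_Algebra.real_inner_class.orthogonal_def[symmetric]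
    by (rule orthogonal_to_subspace_exists) blast
  define e where "e = w /\<^sub>R norm w"
  have "inner a b = 0" "inner a e = 0" "inner b e = 0"
    using y(2)[of a] w(2)[of a] w(2)[of b]
    by (auto simp: b_def e_def span_base inner_commute)
  moreover have "inner b b = 1" "inner e e = 1"
    unfolding b_def e_def by (intro normalise y w)+
  ultimately show ?thesis
    using that[OF ra] by blast
qed

theorem theorem6p4:
  fixes \<Omega> :: "'a::euclidean_space set"
    and k :: real
    and F :: "'a \<Rightarrow> complex"
    and T :: "('a \<Rightarrow> complex) \<Rightarrow> ('a \<Rightarrow> complex)"
  assumes "DIM('a) \<ge> 3"
    and "k > 0"
    and "open \<Omega>" and "connected \<Omega>" and "\<Omega> \<noteq> {}" and "bounded \<Omega>"
    and "set_integrable lebesgue \<Omega> F"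
    and "compact_support_in \<Omega> F"
    and "is_toeplitz_operator k \<Omega> F T"
    and "finite_rank_on (helmholtz_space k \<Omega>) T"
  shows "AE x in lebesgue. x \<in> \<Omega> \<longrightarrow> F x = 0"
proof -
  obtain K where K: "compact K" "AE x in lebesgue. x \<in> \<Omega> - K \<longrightarrow> F x = 0"
    using assms(8) unfolding compact_support_in_def by blast
  \<comment> \<open>Cutting \<open>F\<close> off makes it vanish at every point outside
    \<open>K\<close>, as \<open>fourier_uniqueness\<close> demands, whereas the support condition on
    \<open>F\<close> holds only almost everywhere.\<close>
  define f where "f x = indicat_real K x *\<^sub>R (indicat_real \<Omega> x *\<^sub>R F x)" for x
  have "AE x in lebesgue. f x = 0"
  proof (rule fourier_uniqueness[OF _ K(1)])
    show "integrable lebesgue f"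
      unfolding f_def[abs_def]
      by (rule integrable_mult_indicator[OF _ assms(7)[unfolded set_integrable_def]])
        (use K(1) in \<open>auto simp: borel_compact\<close>)
    show "(\<integral>x. f x * exp (\<i> * of_real (inner \<xi> x)) \<partial>lebesgue) = 0" for \<xi>
    proof -
      obtain r a b e where "\<xi> = r *\<^sub>R a" "inner a a = 1" "inner b b = 1" "inner e e = 1"
        "inner a b = 0" "inner a e = 0" "inner b e = 0"
        using orthonormal_triple_containing_direction[OF assms(1)] by blast
      then show ?thesis
        using fourier_vanishes_on_line[OF assms(3,6,7) K assms(9,10) _ _ _ _ _ _ f_def] by simp
    qed
  qed (simp add: f_def)
  \<comment> \<open>On \<open>K\<close> inside \<open>\<Omega>\<close> the functions
    \<open>f\<close> and \<open>F\<close> agree; on the rest of \<open>\<Omega>\<close> the support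
    condition applies.\<close>
  then show ?thesis
    using K(2) by eventually_elim (auto simp: f_def indicator_def split: if_splits)
qed

end
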